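(* Let $G$ be a finite Frobenius group with Frobenius kernel $N$ and Frobenius complement $H$. Then $$|G|A_G(t)=\frac{1}{1-|G|t}+\left(|N|A_N(t)-\frac{1}{1-|N|t}\right)+|N|\left(|H|A_H(t)-\frac{1}{1-|H|t}\right).$$
   Context: A finite group $G$ is a Frobenius group if it has a proper non-trivial subgroup $H$ (a Frobenius complement) such that $H\cap gHg^{-1}=\{1\}$ for all $g\in G\setminus H$; the Frobenius kernel is $N=\left(G\setminus\bigcup_{g\in G}gHg^{-1}\right)\cup\{1\}$, which is a normal subgroup with $G=N\rtimes H$. For a finite group $G$ and $n\ge0$, let $\alpha_{G,n}$ be the number of orbits of $G$ acting on $G^n$ by simultaneous conjugation, and $A_G(t)=\sum_{n\ge0}\alpha_{G,n}t^n$. *)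

theory Defs
  imports "HOL-Algebra.Group" "HOL-Library.FuncSet" "HOL-Computational_Algebra.Formal_Power_Series"
begin

definition conj_set :: "('a, 'b) monoid_scheme \<Rightarrow> 'a \<Rightarrow> 'a set \<Rightarrow> 'a set" where
  "conj_set G g H = {g \<otimes>\<^bsub>G\<^esub> h \<otimes>\<^bsub>G\<^esub> inv\<^bsub>G\<^esub> g | h. h \<in> H}"

definition frobenius_complement :: "('a, 'b) monoid_scheme \<Rightarrow> 'a set \<Rightarrow> bool" where
  "frobenius_complement G H \<longleftrightarrow>
     subgroup H G \<and> H \<noteq> {\<one>\<^bsub>G\<^esub>} \<and> H \<noteq> carrier G \<and>
     (\<forall>g \<in> carrier G - H. H \<inter> conj_set G g H = {\<one>\<^bsub>G\<^esub>})"

definition frobenius_kernel :: "('a, 'b) monoid_scheme \<Rightarrow> 'a set \<Rightarrow> 'a set" where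
  "frobenius_kernel G H =
     (carrier G - (\<Union>g \<in> carrier G. conj_set G g H)) \<union> {\<one>\<^bsub>G\<^esub>}"

definition tuples :: "('a, 'b) monoid_scheme \<Rightarrow> nat \<Rightarrow> (nat \<Rightarrow> 'a) set" where
  "tuples G n = {0..<n} \<rightarrow>\<^sub>E carrier G"

definition sim_conj_rel :: "('a, 'b) monoid_scheme \<Rightarrow> nat \<Rightarrow> ((nat \<Rightarrow> 'a) \<times> (nat \<Rightarrow> 'a)) set" where
  "sim_conj_rel G n = {(x, y). x \<in> tuples G n \<and> y \<in> tuples G n \<and>
      (\<exists>g \<in> carrier G. \<forall>i < n. y i = g \<otimes>\<^bsub>G\<^esub> x i \<otimes>\<^bsub>G\<^esub> inv\<^bsub>G\<^esub> g)}"

definition alpha :: "('a, 'b) monoid_scheme \<Rightarrow> nat \<Rightarrow> nat" where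
  "alpha G n = card (tuples G n // sim_conj_rel G n)"

definition A_fps :: "('a, 'b) monoid_scheme \<Rightarrow> rat fps" where
  "A_fps G = Abs_fps (\<lambda>n. of_nat (alpha G n))"

end

theory Submission
  imports Defs "HOL-Library.Function_Algebras" "HOL-Computational_Algebra.Fundamental_Theorem_Algebra"
begin

text \<open>
  Burnside's lemma turns \<open>|K| A\<^sub>K(t)\<close> into the sum of \<open>1 / (1 - |C\<^sub>K(g)| t)\<close> over \<open>g \<in> K\<close>.
  In a Frobenius group the centraliser of a nontrivial element of \<open>N\<close> lies in \<open>N\<close>, that of a
  nontrivial element of \<open>H\<close> lies in \<open>H\<close>, and \<open>G - N\<close> consists of \<open>|N|\<close> copies of \<open>H - {1}\<close> under
  conjugation; splitting the sum over \<open>G\<close> accordingly gives the formula.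

  Burnside's lemma for \<open>N\<close> needs \<open>N\<close> to be a subgroup, which is Frobenius's theorem. Its
  character-theoretic proof is carried out inside the group algebra \<open>\<complex>[G]\<close> with its involution.
  Minimal self-adjoint idempotents \<open>p\<close> play the role of irreducible representations, and
  multiplicities are integers because they are traces of Hermitian idempotents. An irreducible
  character \<open>\<chi>\<close> of \<open>H\<close> extends to the virtual character of \<open>G\<close> of norm 1 that is constantly
  \<open>\<chi>(1)\<close> on \<open>N\<close>; its multiplicity in an irreducible representation is an integer greater
  than \<open>-1\<close>, hence nonnegative. Summing over all \<open>\<chi>\<close> with weights \<open>\<chi>(1)\<close> makes the indicator
  function of \<open>N\<close> positive definite, and the set where a positive definite function takes its
  value at 1 is a subgroup.
\<close>

section \<open>Linear algebra\<close>

text \<open>The diagonal entries of a Hermitian idempotent are sums of squared moduli, so the trace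
  is nonnegative, and removing a rank-one projection lowers it by exactly one. A descent from any
  integer above the trace therefore ends at trace 0.\<close>

lemma trace_hermitian_idempotent_nat:
  fixes K :: "'a \<Rightarrow> 'a \<Rightarrow> complex"
  assumes "finite X"
    and "\<And>x y. x \<in> X \<Longrightarrow> y \<in> X \<Longrightarrow> K y x = cnj (K x y)"
    and "\<And>x y. x \<in> X \<Longrightarrow> y \<in> X \<Longrightarrow> (\<Sum>z\<in>X. K x z * K z y) = K x y"
  shows "(\<Sum>x\<in>X. K x x) \<in> \<nat>"
proof -
  have diag: "K x x = of_real (\<Sum>z\<in>X. (cmod (K x z))\<^sup>2)"
    if x: "x \<in> X" and h: "\<And>x y. x \<in> X \<Longrightarrow> y \<in> X \<Longrightarrow> K y x = cnj (K x y)"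
      and i: "\<And>x y. x \<in> X \<Longrightarrow> y \<in> X \<Longrightarrow> (\<Sum>z\<in>X. K x z * K z y) = K x y"
    for K :: "'a \<Rightarrow> 'a \<Rightarrow> complex" and x
  proof -
    have "K x x = (\<Sum>z\<in>X. K x z * K z x)" using i x by simp
    also have "\<dots> = (\<Sum>z\<in>X. of_real ((cmod (K x z))\<^sup>2))"
    proof (rule sum.cong)
      fix z assume z: "z \<in> X"
      show "K x z * K z x = of_real ((cmod (K x z))\<^sup>2)"
        unfolding complex_norm_square h[OF x z] ..
    qed simp
    finally show ?thesis by simp
  qed
  have nat: "(\<Sum>x\<in>X. K x x) \<in> \<nat>"
    if "Re (\<Sum>x\<in>X. K x x) < of_nat n"
      and "\<And>x y. x \<in> X \<Longrightarrow> y \<in> X \<Longrightarrow> K y x = cnj (K x y)"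
      and "\<And>x y. x \<in> X \<Longrightarrow> y \<in> X \<Longrightarrow> (\<Sum>z\<in>X. K x z * K z y) = K x y"
    for n and K :: "'a \<Rightarrow> 'a \<Rightarrow> complex"
    using that
  proof (induction n arbitrary: K)
    \<comment> \<open>The strict bound makes this case vacuous: it would force a negative
      trace.\<close>
    case 0
    have "Re (K x x) \<ge> 0" if "x \<in> X" for x
      using arg_cong[OF diag[of x K, OF that 0(2,3)], of Re] by (simp add: sum_nonneg)
    hence "Re (\<Sum>x\<in>X. K x x) \<ge> 0" by (simp add: sum_nonneg)
    with 0(1) show ?case by simp
  next
    case (Suc n)
    show ?case
    proof (cases "\<forall>y\<in>X. K y y = 0")
      case True
      thus ?thesis by simp
    next
      case False
      then obtain y where y: "y \<in> X" "K y y \<noteq> 0" by blast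
      define k where "k = K y y"
      have k0: "k \<noteq> 0" and kc: "cnj k = k" using y Suc.prems(2)[of y y] unfolding k_def by metis+
      \<comment> \<open>split off the rank-one projection onto a nonzero column, which lowers the trace by one\<close>
      define K' where "K' x z = K x z - K x y * K y z / k" for x z
      have h: "K' z x = cnj (K' x z)" if "x \<in> X" "z \<in> X" for x z
        using Suc.prems(2)[OF that] Suc.prems(2)[of x y] Suc.prems(2)[of y z] that y kc
        by (simp add: K'_def)
      have i: "(\<Sum>w\<in>X. K' x w * K' w z) = K' x z" if xz: "x \<in> X" "z \<in> X" for x z
      proof -
        have "(\<Sum>w\<in>X. K' x w * K' w z) = (\<Sum>w\<in>X. K x w * K w z)
            - (\<Sum>w\<in>X. K x w * K w y) * (K y z / k) - (K x y / k) * (\<Sum>w\<in>X. K y w * K w z)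
            + (K x y / k) * (\<Sum>w\<in>X. K y w * K w y) * (K y z / k)"
          unfolding sum_distrib_left sum_distrib_right sum_subtractf[symmetric] sum.distrib[symmetric]
          by (rule sum.cong) (simp_all add: K'_def algebra_simps)
        also have "\<dots> = K' x z"
          using Suc.prems(3) xz y k0 by (simp add: K'_def k_def)
        finally show ?thesis .
      qed
      have "(\<Sum>x\<in>X. K' x x) = (\<Sum>x\<in>X. K x x) - (\<Sum>x\<in>X. K y x * K x y) / k"
        unfolding sum_divide_distrib sum_subtractf[symmetric]
        by (rule sum.cong) (simp_all add: K'_def mult.commute)
      hence t: "(\<Sum>x\<in>X. K' x x) = (\<Sum>x\<in>X. K x x) - 1"
        using Suc.prems(3)[of y y] y k0 by (simp add: k_def)
      have "(\<Sum>x\<in>X. K' x x) \<in> \<nat>"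
      proof (rule Suc.IH[of K'])
        show "Re (\<Sum>x\<in>X. K' x x) < of_nat n" using t Suc.prems(1) by simp
      qed (fact h i)+
      hence "(\<Sum>x\<in>X. K' x x) + 1 \<in> \<nat>" by (rule Nats_add) simp
      thus ?thesis using t by simp
    qed
  qed
  obtain n where "Re (\<Sum>x\<in>X. K x x) < of_nat n" using reals_Archimedean2 by blast
  from nat[OF this assms(2,3)] show ?thesis .
qed

text \<open>Gaussian elimination on the equation \<open>x0\<close>: either all its coefficients
  vanish, or a pivot unknown \<open>i0\<close> is eliminated, which costs one equation and one
  unknown.\<close>

lemma underdetermined_system:
  fixes v :: "'i \<Rightarrow> 'a \<Rightarrow> 'c :: field"
  assumes "finite X" "finite I" "card X < card I"
  shows "\<exists>c. (\<exists>i\<in>I. c i \<noteq> 0) \<and> (\<forall>x\<in>X. (\<Sum>i\<in>I. c i * v i x) = 0)"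
  using assms
proof (induction X arbitrary: I v rule: finite_induct)
  case empty
  then obtain i where "i \<in> I" by fastforce
  thus ?case by (intro exI[of _ "\<lambda>_. 1"]) auto
next
  case (insert x0 X)
  show ?case
  proof (cases "\<forall>i\<in>I. v i x0 = 0")
    case True
    have "card X < card I" using insert.prems insert.hyps by simp
    then obtain c where c: "\<exists>i\<in>I. c i \<noteq> 0" "\<And>x. x \<in> X \<Longrightarrow> (\<Sum>i\<in>I. c i * v i x) = 0"
      using insert.IH[OF insert.prems(1), of v] by blast
    moreover have "(\<Sum>i\<in>I. c i * v i x0) = 0" using True by simp
    ultimately show ?thesis by (intro exI[of _ c]) auto
  next
    case False
    then obtain i0 where i0: "i0 \<in> I" "v i0 x0 \<noteq> 0" by blast
    let ?J = "I - {i0}"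
    have J: "finite ?J" "card X < card ?J" using insert.prems insert.hyps i0 by auto
    obtain c where c: "\<exists>i\<in>?J. c i \<noteq> 0"
      "\<And>x. x \<in> X \<Longrightarrow> (\<Sum>i\<in>?J. c i * (v i x - v i x0 / v i0 x0 * v i0 x)) = 0"
      using insert.IH[OF J, of "\<lambda>i x. v i x - v i x0 / v i0 x0 * v i0 x"] by blast
    \<comment> \<open>The value at \<open>i0\<close> solves equation \<open>x0\<close>; substituting
      it into the other equations gives the reduced system.\<close>
    define d where "d = c(i0 := - (\<Sum>i\<in>?J. c i * v i x0 / v i0 x0))"
    have s: "(\<Sum>i\<in>I. d i * v i x) = (\<Sum>i\<in>?J. c i * (v i x - v i x0 / v i0 x0 * v i0 x))" for x
    proof -
      have "(\<Sum>i\<in>I. d i * v i x) = d i0 * v i0 x + (\<Sum>i\<in>?J. d i * v i x)"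
        using i0 insert.prems by (simp add: sum.remove)
      also have "(\<Sum>i\<in>?J. d i * v i x) = (\<Sum>i\<in>?J. c i * v i x)"
        by (rule sum.cong) (auto simp: d_def)
      finally show ?thesis
        by (simp add: d_def sum_subtractf algebra_simps sum_distrib_left)
    qed
    have "(\<Sum>i\<in>I. d i * v i x) = 0" if "x \<in> insert x0 X" for x
      unfolding s using that c(2) i0 by auto
    moreover have "\<exists>i\<in>I. d i \<noteq> 0" using c(1) by (auto simp: d_def)
    ultimately show ?thesis by blast
  qed
qed

text \<open>Applied to the successive powers of an element, this produces a nonzero polynomial that
  annihilates it.\<close>

lemma polynomial_relation:
  fixes v :: "nat \<Rightarrow> 'a \<Rightarrow> 'c :: field"
  assumes "finite X"
  shows "\<exists>f. f \<noteq> 0 \<and> (\<forall>x\<in>X. (\<Sum>k\<le>degree f. coeff f k * v k x) = 0)"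
proof -
  obtain c where c: "\<exists>i\<in>{..card X}. c i \<noteq> 0"
    "\<And>x. x \<in> X \<Longrightarrow> (\<Sum>i\<le>card X. c i * v i x) = 0"
    using underdetermined_system[OF assms, of "{..card X}" v] by auto
  define f where "f = (\<Sum>i\<le>card X. monom (c i) i)"
  have f: "coeff f k = (if k \<le> card X then c k else 0)" for k
    by (simp add: f_def coeff_sum if_distrib sum.delta' cong: if_cong)
  have f0: "f \<noteq> 0" using c(1) f by (metis atMost_iff coeff_0)
  have "degree f \<le> card X" by (rule degree_le) (simp add: f)
  hence "(\<Sum>k\<le>degree f. coeff f k * v k x) = (\<Sum>k\<le>card X. c k * v k x)" for x
  proof -
    have "(\<Sum>k\<le>degree f. coeff f k * v k x) = (\<Sum>k\<le>card X. coeff f k * v k x)"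
      using \<open>degree f \<le> card X\<close> by (intro sum.mono_neutral_left) (auto intro: coeff_eq_0)
    thus ?thesis using f by simp
  qed
  thus ?thesis using c(2) f0 by auto
qed

section \<open>The group algebra\<close>

text \<open>The value 0 off the carrier, here and in \<open>adj\<close>, lets elements of the
  algebra be compared as plain functions, as in \<open>falg_eqI\<close>.\<close>

definition conv :: "('a, 'b) monoid_scheme \<Rightarrow> ('a \<Rightarrow> complex) \<Rightarrow> ('a \<Rightarrow> complex) \<Rightarrow> 'a \<Rightarrow> complex" where
  "conv G f g = (\<lambda>x. if x \<in> carrier G
     then \<Sum>y\<in>carrier G. f y * g (inv\<^bsub>G\<^esub> y \<otimes>\<^bsub>G\<^esub> x) else 0)"

text \<open>The involution for which left convolution by \<open>adj G f\<close> is the Hermitian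
  adjoint of left convolution by \<open>f\<close>.\<close>

definition adj :: "('a, 'b) monoid_scheme \<Rightarrow> ('a \<Rightarrow> complex) \<Rightarrow> 'a \<Rightarrow> complex" where
  "adj G f = (\<lambda>x. if x \<in> carrier G then cnj (f (inv\<^bsub>G\<^esub> x)) else 0)"

definition scl :: "complex \<Rightarrow> ('a \<Rightarrow> complex) \<Rightarrow> 'a \<Rightarrow> complex" where
  "scl c f = (\<lambda>x. c * f x)"

definition falg :: "('a, 'b) monoid_scheme \<Rightarrow> ('a \<Rightarrow> complex) set" where
  "falg G = {f. \<forall>x. x \<notin> carrier G \<longrightarrow> f x = 0}"

definition point_mass :: "'a \<Rightarrow> 'a \<Rightarrow> complex" where
  "point_mass x y = (if y = x then 1 else 0)"

text \<open>
  For idempotents \<open>p\<close> and \<open>q\<close> this is the trace of \<open>x \<mapsto> p x q\<close> on \<open>\<complex>[G]\<close>, that is, the dimension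
  of the space of homomorphisms between the left ideals generated by \<open>p\<close> and \<open>q\<close>.
\<close>

definition pairing :: "('a, 'b) monoid_scheme \<Rightarrow> ('a \<Rightarrow> complex) \<Rightarrow> ('a \<Rightarrow> complex) \<Rightarrow> complex" where
  "pairing G f g = (\<Sum>x\<in>carrier G. \<Sum>y\<in>carrier G.
     f (x \<otimes>\<^bsub>G\<^esub> y \<otimes>\<^bsub>G\<^esub> inv\<^bsub>G\<^esub> x) * g (inv\<^bsub>G\<^esub> y))"

text \<open>
  For an idempotent \<open>f\<close> this is the dual of the character of the left ideal \<open>\<complex>[G] f\<close>; for \<open>f\<close> supported
  on a subgroup it is induced from there.
\<close>

definition class_sum :: "('a, 'b) monoid_scheme \<Rightarrow> ('a \<Rightarrow> complex) \<Rightarrow> 'a \<Rightarrow> complex" where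
  "class_sum G f y = (\<Sum>x\<in>carrier G. f (x \<otimes>\<^bsub>G\<^esub> y \<otimes>\<^bsub>G\<^esub> inv\<^bsub>G\<^esub> x))"

text \<open>For a subgroup \<open>K\<close> this idempotent affords the trivial representation of
  \<open>K\<close>, and its \<open>class_sum\<close> over \<open>G\<close> is the permutation
  character on the cosets of \<open>K\<close>.\<close>

definition uniform :: "'a set \<Rightarrow> 'a \<Rightarrow> complex" where
  "uniform K x = (if x \<in> K then 1 / of_nat (card K) else 0)"

definition projection :: "('a, 'b) monoid_scheme \<Rightarrow> ('a \<Rightarrow> complex) \<Rightarrow> bool" where
  "projection G p \<longleftrightarrow> p \<in> falg G \<and> adj G p = p \<and> conv G p p = p"

text \<open>The one-dimensional corner is Schur's lemma for the left ideal of \<open>p\<close>,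
  taken as the definition of irreducibility; \<open>proper_subprojection\<close> links it to
  indecomposability.\<close>

definition minimal_projection :: "('a, 'b) monoid_scheme \<Rightarrow> ('a \<Rightarrow> complex) \<Rightarrow> bool" where
  "minimal_projection G p \<longleftrightarrow> projection G p \<and> p \<noteq> 0 \<and>
     (\<forall>f \<in> falg G. \<exists>c. conv G p (conv G f p) = scl c p)"

locale fin_group = group G for G (structure) +
  assumes finite_carrier [simp, intro]: "finite (carrier G)"
begin

lemma inv_cancel_left [simp]:
  assumes "x \<in> carrier G" "y \<in> carrier G"
  shows "inv x \<otimes> (x \<otimes> y) = y" "x \<otimes> (inv x \<otimes> y) = y"
  using assms by (simp_all add: m_assoc[symmetric])

lemma sum_inv: "(\<Sum>x\<in>carrier G. f (inv x)) = (\<Sum>x\<in>carrier G. f x)"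
  by (rule sum.reindex_bij_witness[of _ "\<lambda>x. inv x" "\<lambda>x. inv x"]) auto

lemma sum_mult_left:
  "a \<in> carrier G \<Longrightarrow> (\<Sum>x\<in>carrier G. f (a \<otimes> x)) = (\<Sum>x\<in>carrier G. f x)"
  by (rule sum.reindex_bij_witness[of _ "\<lambda>x. inv a \<otimes> x" "\<lambda>x. a \<otimes> x"]) auto

lemma sum_mult_right:
  "a \<in> carrier G \<Longrightarrow> (\<Sum>x\<in>carrier G. f (x \<otimes> a)) = (\<Sum>x\<in>carrier G. f x)"
  by (rule sum.reindex_bij_witness[of _ "\<lambda>x. x \<otimes> inv a" "\<lambda>x. x \<otimes> a"]) (auto simp: m_assoc)

lemma falgD: "f \<in> falg G \<Longrightarrow> x \<notin> carrier G \<Longrightarrow> f x = 0"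
  by (simp add: falg_def)

lemma falg_eqI:
  "f \<in> falg G \<Longrightarrow> g \<in> falg G \<Longrightarrow> (\<And>x. x \<in> carrier G \<Longrightarrow> f x = g x) \<Longrightarrow> f = g"
  by (rule ext, case_tac "x \<in> carrier G") (simp_all add: falgD)

lemma falg_closed [simp, intro]:
  "conv G f g \<in> falg G" "adj G f \<in> falg G" "0 \<in> falg G"
  "f \<in> falg G \<Longrightarrow> scl c f \<in> falg G"
  "f \<in> falg G \<Longrightarrow> g \<in> falg G \<Longrightarrow> f + g \<in> falg G"
  "f \<in> falg G \<Longrightarrow> g \<in> falg G \<Longrightarrow> f - g \<in> falg G"
  "x \<in> carrier G \<Longrightarrow> point_mass x \<in> falg G"
  by (auto simp: falg_def conv_def adj_def scl_def minus_apply point_mass_def)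

lemma conv_assoc: "conv G (conv G f g) h = conv G f (conv G g h)"
proof (rule falg_eqI)
  fix x assume x: "x \<in> carrier G"
  have "conv G (conv G f g) h x = (\<Sum>y\<in>carrier G. \<Sum>z\<in>carrier G. f z * g (inv z \<otimes> y) * h (inv y \<otimes> x))"
    using x by (simp add: conv_def sum_distrib_right)
  also have "\<dots> = (\<Sum>z\<in>carrier G. \<Sum>y\<in>carrier G. f z * g (inv z \<otimes> y) * h (inv y \<otimes> x))"
    by (rule sum.swap)
  also have "\<dots> = (\<Sum>z\<in>carrier G. \<Sum>y\<in>carrier G. f z * g y * h (inv y \<otimes> (inv z \<otimes> x)))"
  proof (rule sum.cong)
    fix z assume z: "z \<in> carrier G"
    show "(\<Sum>y\<in>carrier G. f z * g (inv z \<otimes> y) * h (inv y \<otimes> x))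
        = (\<Sum>y\<in>carrier G. f z * g y * h (inv y \<otimes> (inv z \<otimes> x)))"
      by (subst sum_mult_left[OF z, symmetric], rule sum.cong)
        (use x z in \<open>simp_all add: inv_mult_group m_assoc\<close>)
  qed simp
  also have "\<dots> = conv G f (conv G g h) x"
    using x by (simp add: conv_def sum_distrib_left mult.assoc)
  finally show "conv G (conv G f g) h x = conv G f (conv G g h) x" .
qed auto

lemma conv_linear [simp]:
  "conv G (f + g) h = conv G f h + conv G g h"
  "conv G f (g + h) = conv G f g + conv G f h"
  "conv G (f - g) h = conv G f h - conv G g h"
  "conv G f (g - h) = conv G f g - conv G f h"
  "conv G (scl c f) g = scl c (conv G f g)"
  "conv G f (scl c g) = scl c (conv G f g)"
  "conv G 0 f = 0" "conv G f 0 = 0"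
  by (simp_all add: conv_def scl_def minus_apply fun_eq_iff distrib_left distrib_right
      left_diff_distrib right_diff_distrib sum.distrib sum_subtractf sum_distrib_left mult_ac)

lemma adj_linear [simp]:
  "adj G (f + g) = adj G f + adj G g"
  "adj G (f - g) = adj G f - adj G g"
  "adj G (scl c f) = scl (cnj c) (adj G f)"
  "adj G 0 = 0"
  by (auto simp: adj_def scl_def minus_apply fun_eq_iff)

lemma adj_adj: "f \<in> falg G \<Longrightarrow> adj G (adj G f) = f"
  by (rule falg_eqI) (auto simp: adj_def falg_def)

lemma adj_conv: "adj G (conv G f g) = conv G (adj G g) (adj G f)"
proof (rule falg_eqI)
  fix x assume x: "x \<in> carrier G"
  have "adj G (conv G f g) x = (\<Sum>y\<in>carrier G. cnj (f y) * cnj (g (inv y \<otimes> inv x)))"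
    using x by (simp add: conv_def adj_def)
  also have "\<dots> = (\<Sum>y\<in>carrier G. cnj (f (inv x \<otimes> y)) * cnj (g (inv (inv x \<otimes> y) \<otimes> inv x)))"
    by (rule sum_mult_left[symmetric]) (use x in simp)
  also have "\<dots> = conv G (adj G g) (adj G f) x"
    using x by (auto simp: conv_def adj_def inv_mult_group m_assoc intro!: sum.cong)
  finally show "adj G (conv G f g) x = conv G (adj G g) (adj G f) x" .
qed auto

lemma sum_point_mass: "x \<in> carrier G \<Longrightarrow> (\<Sum>y\<in>carrier G. point_mass x y * f y) = f x"
  by (simp add: point_mass_def if_distrib[of "\<lambda>u. u * _"] sum.delta cong: if_cong)

lemma conv_point_mass:
  "x \<in> carrier G \<Longrightarrow> y \<in> carrier G \<Longrightarrow> conv G (point_mass x) f y = f (inv x \<otimes> y)"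
  by (simp add: conv_def sum_point_mass)

lemma conv_one: "f \<in> falg G \<Longrightarrow> conv G (point_mass \<one>) f = f"
  by (rule falg_eqI) (auto simp: conv_point_mass)

lemma adj_one: "adj G (point_mass \<one>) = point_mass \<one>"
  by (rule falg_eqI) (auto simp: adj_def point_mass_def falg_def)

section \<open>Projections and the integrality of their pairings\<close>

lemma projection_one: "projection G (point_mass \<one>)"
  by (simp add: projection_def adj_one conv_one)

lemma projection_inv:
  assumes "projection G p" "x \<in> carrier G"
  shows "p (inv x) = cnj (p x)"
proof -
  have "p (inv x) = adj G p (inv x)" using assms by (simp add: projection_def)
  thus ?thesis using assms by (simp add: adj_def)
qed

lemma projection_conv:
  assumes "projection G p" "x \<in> carrier G"
  shows "(\<Sum>y\<in>carrier G. p y * p (inv y \<otimes> x)) = p x"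
proof -
  have "p x = conv G p p x" using assms by (simp add: projection_def)
  thus ?thesis using assms(2) by (simp add: conv_def)
qed

lemma adj_conv_at_one:
  assumes "f \<in> falg G"
  shows "conv G (adj G f) f \<one> = of_real (\<Sum>x\<in>carrier G. (cmod (f x))\<^sup>2)"
proof -
  have "conv G (adj G f) f \<one> = (\<Sum>x\<in>carrier G. cnj (f (inv x)) * f (inv x))"
    by (simp add: conv_def adj_def)
  also have "\<dots> = (\<Sum>x\<in>carrier G. cnj (f x) * f x)" by (rule sum_inv)
  also have "\<dots> = (\<Sum>x\<in>carrier G. of_real ((cmod (f x))\<^sup>2))"
    by (rule sum.cong) (simp_all only: complex_norm_square mult.commute)
  finally show ?thesis by simp
qed

lemma adj_conv_nonzero:
  assumes "f \<in> falg G" "f \<noteq> 0"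
  shows "Re (conv G (adj G f) f \<one>) > 0"
proof -
  obtain x where x: "x \<in> carrier G" "f x \<noteq> 0"
    using assms falg_eqI[of f 0] by auto
  hence "(\<Sum>x\<in>carrier G. (cmod (f x))\<^sup>2) > 0" by (intro sum_pos2[of _ x]) auto
  thus ?thesis by (simp add: adj_conv_at_one[OF assms(1)])
qed

lemma projection_at_one:
  assumes "projection G p"
  shows "p \<one> = of_real (\<Sum>x\<in>carrier G. (cmod (p x))\<^sup>2)" "p \<noteq> 0 \<Longrightarrow> Re (p \<one>) > 0"
    "p \<one> = of_real (Re (p \<one>))"
proof -
  have p: "p \<in> falg G" "conv G (adj G p) p = p" using assms by (simp_all add: projection_def)
  show *: "p \<one> = of_real (\<Sum>x\<in>carrier G. (cmod (p x))\<^sup>2)"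
    using adj_conv_at_one[OF p(1)] unfolding p(2) .
  show "Re (p \<one>) > 0" if "p \<noteq> 0"
    using adj_conv_nonzero[OF p(1) that] unfolding p(2) .
  show "p \<one> = of_real (Re (p \<one>))" using arg_cong[OF *, of Re] * by (simp del: of_real_sum)
qed

text \<open>\<open>L\<close> and \<open>R\<close> are the matrices of left convolution by
  \<open>p\<close> and right convolution by \<open>q\<close>. They are commuting Hermitian
  idempotents, so their product \<open>K\<close> is one too, and its trace is the pairing.\<close>

lemma pairing_nat:
  assumes p: "projection G p" and q: "projection G q"
  shows "pairing G p q \<in> \<nat>"
proof -
  define L where "L x z = p (x \<otimes> inv z)" for x z
  define R where "R x z = q (inv z \<otimes> x)" for x z
  define K where "K x z = (\<Sum>w\<in>carrier G. L x w * R w z)" for x z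
  have comm: "K x z = (\<Sum>w\<in>carrier G. R x w * L w z)" if xz: "x \<in> carrier G" "z \<in> carrier G" for x z
    unfolding K_def L_def R_def
    by (rule sum.reindex_bij_witness[of _ "\<lambda>w. z \<otimes> inv w \<otimes> x" "\<lambda>w. x \<otimes> inv w \<otimes> z"])
      (use xz in \<open>auto simp: inv_mult_group m_assoc\<close>)
  have L: "(\<Sum>w\<in>carrier G. L x w * L w z) = L x z" if xz: "x \<in> carrier G" "z \<in> carrier G" for x z
  proof -
    have "(\<Sum>w\<in>carrier G. L x w * L w z) = (\<Sum>y\<in>carrier G. p y * p (inv y \<otimes> (x \<otimes> inv z)))"
      unfolding L_def
      by (rule sum.reindex_bij_witness[of _ "\<lambda>y. inv y \<otimes> x" "\<lambda>w. x \<otimes> inv w"])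
        (use xz in \<open>auto simp: inv_mult_group m_assoc\<close>)
    thus ?thesis using projection_conv[OF p] xz by (simp add: L_def)
  qed
  have R: "(\<Sum>w\<in>carrier G. R x w * R w z) = R x z" if xz: "x \<in> carrier G" "z \<in> carrier G" for x z
  proof -
    have "(\<Sum>w\<in>carrier G. R x w * R w z) = (\<Sum>y\<in>carrier G. q y * q (inv y \<otimes> (inv z \<otimes> x)))"
      unfolding R_def
      by (rule sum.reindex_bij_witness[of _ "\<lambda>y. z \<otimes> y" "\<lambda>w. inv z \<otimes> w"])
        (use xz in \<open>auto simp: inv_mult_group m_assoc\<close>)
    thus ?thesis using projection_conv[OF q] xz by (simp add: R_def)
  qed
  have Lh: "L z x = cnj (L x z)" if xz: "x \<in> carrier G" "z \<in> carrier G" for x z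
    using projection_inv[OF p, of "x \<otimes> inv z"] xz by (simp add: L_def inv_mult_group)
  have Rh: "R z x = cnj (R x z)" if xz: "x \<in> carrier G" "z \<in> carrier G" for x z
    using projection_inv[OF q, of "inv z \<otimes> x"] xz by (simp add: R_def inv_mult_group)
  have "(\<Sum>x\<in>carrier G. K x x) \<in> \<nat>"
  proof (rule trace_hermitian_idempotent_nat[of _ K])
    fix x z assume xz: "x \<in> carrier G" "z \<in> carrier G"
    have "cnj (K x z) = (\<Sum>w\<in>carrier G. cnj (L x w) * cnj (R w z))" by (simp add: K_def)
    also have "\<dots> = (\<Sum>w\<in>carrier G. R z w * L w x)"
      using xz by (intro sum.cong refl) (simp add: Lh[OF xz(1)] Rh[OF _ xz(2)])
    finally show "K z x = cnj (K x z)" using comm xz by simp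
    \<comment> \<open>As matrices: \<open>K K = (L R)(R L) = L R L = L (L R) = L R\<close>, where
      \<open>comm\<close> rewrites the second factor.\<close>
    have "(\<Sum>w\<in>carrier G. K x w * K w z)
        = (\<Sum>w\<in>carrier G. (\<Sum>u\<in>carrier G. L x u * R u w) * (\<Sum>v\<in>carrier G. R w v * L v z))"
      by (rule sum.cong) (use xz comm in \<open>auto simp: K_def\<close>)
    also have "\<dots> = (\<Sum>w\<in>carrier G. \<Sum>u\<in>carrier G. \<Sum>v\<in>carrier G. L x u * R u w * R w v * L v z)"
      by (simp add: sum_product mult.assoc)
    also have "\<dots> = (\<Sum>u\<in>carrier G. \<Sum>w\<in>carrier G. \<Sum>v\<in>carrier G. L x u * R u w * R w v * L v z)"
      by (rule sum.swap)
    also have "\<dots> = (\<Sum>u\<in>carrier G. \<Sum>v\<in>carrier G. \<Sum>w\<in>carrier G. L x u * R u w * R w v * L v z)"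
      by (intro sum.cong refl sum.swap)
    also have "\<dots> = (\<Sum>u\<in>carrier G. \<Sum>v\<in>carrier G. L x u * (\<Sum>w\<in>carrier G. R u w * R w v) * L v z)"
      by (simp add: sum_distrib_left sum_distrib_right mult.assoc)
    also have "\<dots> = (\<Sum>u\<in>carrier G. \<Sum>v\<in>carrier G. L x u * R u v * L v z)"
      using R by (intro sum.cong refl) auto
    also have "\<dots> = (\<Sum>u\<in>carrier G. L x u * (\<Sum>v\<in>carrier G. R u v * L v z))"
      by (simp add: sum_distrib_left mult.assoc)
    also have "\<dots> = (\<Sum>u\<in>carrier G. L x u * (\<Sum>v\<in>carrier G. L u v * R v z))"
      using comm xz by (intro sum.cong refl) (auto simp: K_def)
    also have "\<dots> = (\<Sum>u\<in>carrier G. \<Sum>v\<in>carrier G. L x u * L u v * R v z)"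
      by (simp add: sum_distrib_left mult.assoc)
    also have "\<dots> = (\<Sum>v\<in>carrier G. \<Sum>u\<in>carrier G. L x u * L u v * R v z)"
      by (rule sum.swap)
    also have "\<dots> = (\<Sum>v\<in>carrier G. L x v * R v z)"
      using L xz by (intro sum.cong refl) (auto simp: sum_distrib_right[symmetric])
    finally show "(\<Sum>w\<in>carrier G. K x w * K w z) = K x z" by (simp add: K_def)
  qed simp
  also have "(\<Sum>x\<in>carrier G. K x x) = pairing G p q"
    unfolding pairing_def
  proof (rule sum.cong)
    fix x assume x: "x \<in> carrier G"
    show "K x x = (\<Sum>y\<in>carrier G. p (x \<otimes> y \<otimes> inv x) * q (inv y))"
      unfolding K_def L_def R_def
      by (rule sum.reindex_bij_witness[of _ "\<lambda>y. x \<otimes> inv y" "\<lambda>w. inv w \<otimes> x"])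
        (use x in \<open>auto simp: inv_mult_group m_assoc\<close>)
  qed simp
  finally show ?thesis .
qed

lemma pairing_one: "pairing G (point_mass \<one>) q = of_nat (card (carrier G)) * q \<one>"
proof -
  have "(\<Sum>y\<in>carrier G. point_mass \<one> (x \<otimes> y \<otimes> inv x) * q (inv y)) = q \<one>"
    if x: "x \<in> carrier G" for x
  proof -
    have "x \<otimes> y \<otimes> inv x = \<one> \<longleftrightarrow> y = \<one>" if "y \<in> carrier G" for y
    proof
      assume "x \<otimes> y \<otimes> inv x = \<one>"
      hence "inv x \<otimes> (x \<otimes> y \<otimes> inv x) \<otimes> x = \<one>" using x by simp
      thus "y = \<one>" using x that by (simp add: m_assoc)
    qed (use x in simp)
    hence "(\<Sum>y\<in>carrier G. point_mass \<one> (x \<otimes> y \<otimes> inv x) * q (inv y))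
      = (\<Sum>y\<in>carrier G. point_mass \<one> y * q (inv y))"
      by (intro sum.cong refl) (simp add: point_mass_def)
    thus ?thesis by (simp add: sum_point_mass)
  qed
  thus ?thesis by (simp add: pairing_def)
qed

text \<open>The number is the dimension of the left ideal generated by \<open>p\<close>. It measures
  progress in \<open>projection_decomposition\<close>, and over \<open>H\<close> it is the degree of
  a character in \<open>extension_multiplicity\<close>.\<close>

lemma projection_trace_nat:
  "projection G p \<Longrightarrow> of_nat (card (carrier G)) * p \<one> \<in> \<nat>"
  using pairing_nat[OF projection_one] by (simp add: pairing_one)

text \<open>An irreducible character has norm 1. By minimality, \<open>p\<close> times the point
  mass at \<open>x\<close> times \<open>p\<close> is \<open>c p\<close>. The value at
  \<open>\<one>\<close> gives \<open>c p(1) = p(inv x)\<close>, the value at \<open>x\<close>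
  identifies the inner sum of the pairing with \<open>c p(x)\<close>, and idempotence of
  \<open>p\<close> evaluates the remaining sum over \<open>x\<close>.\<close>

lemma minimal_pairing_self:
  assumes "minimal_projection G p"
  shows "pairing G p p = 1"
proof -
  have p: "projection G p" "p \<noteq> 0" using assms unfolding minimal_projection_def by blast+
  have p1: "p \<one> \<noteq> 0" using projection_at_one(2)[OF p] by auto
  have "(\<Sum>y\<in>carrier G. p (x \<otimes> y \<otimes> inv x) * p (inv y)) = p (inv x) / p \<one> * p x"
    if x: "x \<in> carrier G" for x
  proof -
    obtain c where c: "conv G p (conv G (point_mass x) p) = scl c p"
      using assms x unfolding minimal_projection_def by blast
    have *: "conv G p (conv G (point_mass x) p) z = (\<Sum>s\<in>carrier G. p s * p (inv x \<otimes> (inv s \<otimes> z)))"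
      if z: "z \<in> carrier G" for z
      using z x by (auto simp: conv_def[of G p] conv_point_mass intro!: sum.cong)
    have "(\<Sum>s\<in>carrier G. p s * p (inv x \<otimes> inv s)) = (\<Sum>t\<in>carrier G. p t * p (inv t \<otimes> inv x))"
      by (rule sum.reindex_bij_witness[of _ "\<lambda>t. inv t \<otimes> inv x" "\<lambda>s. inv x \<otimes> inv s"])
        (use x in \<open>auto simp: inv_mult_group m_assoc\<close>)
    hence "c * p \<one> = p (inv x)"
      using *[of \<one>] x projection_conv[OF p(1), of "inv x"] by (simp add: c scl_def)
    hence "c = p (inv x) / p \<one>" using p1 by (simp add: field_simps)
    moreover have "(\<Sum>y\<in>carrier G. p (x \<otimes> y \<otimes> inv x) * p (inv y))
        = (\<Sum>s\<in>carrier G. p s * p (inv x \<otimes> (inv s \<otimes> x)))"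
      by (rule sum.reindex_bij_witness[of _ "\<lambda>s. inv x \<otimes> s \<otimes> x" "\<lambda>y. x \<otimes> y \<otimes> inv x"])
        (use x in \<open>auto simp: inv_mult_group m_assoc\<close>)
    ultimately show ?thesis using *[OF x] by (simp add: c scl_def)
  qed
  hence "pairing G p p = (\<Sum>x\<in>carrier G. p (inv x) * p x) / p \<one>"
    by (simp add: pairing_def sum_divide_distrib)
  also have "(\<Sum>x\<in>carrier G. p (inv x) * p x) = p \<one>"
    using projection_conv[OF p(1), of \<one>] by (simp add: mult.commute)
  finally show ?thesis using p1 by simp
qed

lemma scl_simps:
  "scl c (scl d f) = scl (c * d) f" "scl 1 f = f" "scl 0 f = 0" "scl c 0 = 0"
  "scl c (f + g) = scl c f + scl c g" "scl c f + scl d f = scl (c + d) f"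
  by (simp_all add: scl_def fun_eq_iff algebra_simps)

lemma projection_sub:
  assumes p: "projection G p" and q: "projection G q" and pq: "conv G p q = q" "conv G q p = q"
  shows "projection G (p - q)"
  using p q pq by (simp add: projection_def)

section \<open>Decomposition into minimal projections\<close>

text \<open>The value of \<open>f\<close> at \<open>a\<close> in the corner algebra with unit \<open>p\<close>.\<close>

definition poly_at :: "('a \<Rightarrow> complex) \<Rightarrow> ('a \<Rightarrow> complex) \<Rightarrow> complex poly \<Rightarrow> 'a \<Rightarrow> complex" where
  "poly_at p a f = (\<lambda>x. \<Sum>k\<le>degree f. coeff f k * (conv G a ^^ k) p x)"

text \<open>Horner's scheme, the step in the inductions on polynomials below.\<close>

lemma poly_at_pCons: "poly_at p a (pCons c f) = scl c p + conv G a (poly_at p a f)"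
proof (rule ext)
  fix x
  have "poly_at p a (pCons c f) x = (\<Sum>k\<le>Suc (degree f). coeff (pCons c f) k * (conv G a ^^ k) p x)"
    unfolding poly_at_def by (rule sum.mono_neutral_left) (auto simp: coeff_eq_0 degree_pCons_le)
  also have "\<dots> = c * p x + (\<Sum>k\<le>degree f. coeff f k * conv G a ((conv G a ^^ k) p) x)"
    by (subst sum.atMost_Suc_shift) simp
  also have "(\<Sum>k\<le>degree f. coeff f k * conv G a ((conv G a ^^ k) p) x) = conv G a (poly_at p a f) x"
    by (simp add: conv_def poly_at_def sum_distrib_left sum_distrib_right mult_ac sum.swap[of _ "carrier G"])
  finally show "poly_at p a (pCons c f) x = (scl c p + conv G a (poly_at p a f)) x"
    by (simp add: scl_def)
qed

lemma poly_at_0: "poly_at p a 0 = 0"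
  by (simp add: poly_at_def fun_eq_iff)

lemma poly_at_add_smult: "poly_at p a (smult c f + g) = scl c (poly_at p a f) + poly_at p a g"
proof (rule ext)
  fix x
  define n where "n = max (degree f) (degree g)"
  have ev: "poly_at p a h x = (\<Sum>k\<le>n. coeff h k * (conv G a ^^ k) p x)" if "degree h \<le> n" for h
    unfolding poly_at_def using that by (intro sum.mono_neutral_left) (auto simp: coeff_eq_0)
  have "degree (smult c f + g) \<le> n"
    unfolding n_def by (rule degree_add_le) (auto intro: order_trans[OF degree_smult_le])
  thus "poly_at p a (smult c f + g) x = (scl c (poly_at p a f) + poly_at p a g) x"
    by (simp add: ev n_def[symmetric] scl_def)
      (simp add: ev n_def algebra_simps sum.distrib sum_distrib_left)
qed

lemma poly_at_conv:
  assumes "conv G p b = b" "conv G a b = scl l b"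
  shows "conv G (poly_at p a f) b = scl (poly f l) b"
proof (induction f)
  case 0
  have "conv G (poly_at p a 0) b = scl (poly 0 l) b" by (simp add: poly_at_0 scl_simps)
  thus ?case .
next
  case (pCons c f)
  have "conv G (poly_at p a (pCons c f)) b = scl (poly (pCons c f) l) b"
    using pCons.IH by (simp add: poly_at_pCons conv_assoc assms scl_simps mult.commute)
  thus ?case .
qed

lemma poly_at_closed: "p \<in> falg G \<Longrightarrow> poly_at p a f \<in> falg G"
  by (induction f) (simp_all add: poly_at_0 poly_at_pCons)

lemma poly_at_commute:
  assumes "conv G p a = a" "conv G a p = a"
  shows "conv G (poly_at p a f) a = conv G a (poly_at p a f)"
proof (induction f)
  case 0
  have "conv G (poly_at p a 0) a = conv G a (poly_at p a 0)" by (simp add: poly_at_0)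
  thus ?case .
next
  case (pCons c f)
  have "conv G (poly_at p a (pCons c f)) a = conv G a (poly_at p a (pCons c f))"
    using pCons.IH by (simp add: poly_at_pCons assms conv_assoc)
  thus ?case .
qed

text \<open>Conjugating the coefficients suffices: polynomials in the self-adjoint \<open>a\<close>
  commute with \<open>a\<close>, so the order reversal caused by \<open>adj\<close> is
  harmless.\<close>

lemma adj_poly_at:
  assumes "adj G p = p" "adj G a = a" "conv G p a = a" "conv G a p = a"
  shows "\<exists>g. adj G (poly_at p a f) = poly_at p a g"
proof (induction f)
  case 0
  have "adj G (poly_at p a 0) = poly_at p a 0" by (simp add: poly_at_0)
  thus ?case by (rule exI)
next
  case (pCons c f)
  then obtain g where "adj G (poly_at p a f) = poly_at p a g" by blast
  hence "adj G (poly_at p a (pCons c f)) = poly_at p a (pCons (cnj c) g)"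
    by (simp add: poly_at_pCons assms adj_conv poly_at_commute)
  thus ?case by (rule exI)
qed

lemma poly_at_unit:
  assumes "conv G p p = p" "conv G p a = a"
  shows "conv G p (poly_at p a f) = poly_at p a f"
proof (induction f)
  case 0
  have "conv G p (poly_at p a 0) = poly_at p a 0" by (simp add: poly_at_0)
  thus ?case .
next
  case (pCons c f)
  have "conv G p (poly_at p a (pCons c f)) = poly_at p a (pCons c f)"
    by (simp add: poly_at_pCons assms conv_assoc[symmetric])
  thus ?case .
qed

text \<open>
  If \<open>(X - l) g\<close> is a minimal polynomial of \<open>a\<close>, then \<open>b = g(a)\<close> satisfies \<open>a b = l b\<close>, so \<open>b\<^sup>* b\<close>, with \<open>b\<^sup>*\<close> the
  adjoint of \<open>b\<close> and again a polynomial in \<open>a\<close>, is a nonzero multiple of \<open>b\<close>; rescaling \<open>b\<close> gives a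
  projection.
\<close>

lemma spectral_projection:
  assumes p: "projection G p" "p \<noteq> 0"
    and a: "a \<in> falg G" "adj G a = a" "conv G p a = a" "conv G a p = a"
  obtains q l where "projection G q" "q \<noteq> 0" "conv G p q = q" "conv G a q = scl l q"
proof -
  have pf: "p \<in> falg G" "adj G p = p" "conv G p p = p" using p by (simp_all add: projection_def)
  obtain f0 where f0: "f0 \<noteq> 0"
    "\<And>x. x \<in> carrier G \<Longrightarrow> (\<Sum>k\<le>degree f0. coeff f0 k * (conv G a ^^ k) p x) = 0"
    using polynomial_relation[of "carrier G" "\<lambda>k. (conv G a ^^ k) p"] by auto
  have "poly_at p a f0 = 0"
    by (rule falg_eqI) (use f0(2) poly_at_closed[OF pf(1)] in \<open>auto simp: poly_at_def\<close>)
  with f0(1) obtain f where f: "f \<noteq> 0" "poly_at p a f = 0"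
    and min: "\<And>g. g \<noteq> 0 \<Longrightarrow> poly_at p a g = 0 \<Longrightarrow> degree f \<le> degree g"
    using ex_has_least_nat[of "\<lambda>f. f \<noteq> 0 \<and> poly_at p a f = 0" f0 degree] by blast
  have "degree f \<noteq> 0"
  proof
    assume "degree f = 0"
    then obtain c where c: "f = [:c:]" by (rule degree_eq_zeroE)
    hence "scl c p = 0" "c \<noteq> 0" using f by (simp_all add: poly_at_pCons poly_at_0)
    thus False using p(2) by (simp add: scl_def fun_eq_iff)
  qed
  hence "\<not> constant (poly f)" by (simp add: constant_degree)
  then obtain l where "poly f l = 0" using fundamental_theorem_of_algebra by blast
  then obtain g where g: "f = [:- l, 1:] * g" using poly_eq_0_iff_dvd by blast
  have g0: "g \<noteq> 0" using f(1) g by auto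
  have "degree f = Suc (degree g)" using g0 unfolding g by (subst degree_mult_eq) auto
  hence b0: "poly_at p a g \<noteq> 0" using min[OF g0] by auto
  define b where "b = poly_at p a g"
  have bf: "b \<in> falg G" unfolding b_def by (rule poly_at_closed[OF pf(1)])
  have pb: "conv G p b = b" unfolding b_def by (rule poly_at_unit) (use pf a in simp_all)
  have "f = smult (- l) g + pCons 0 g" using g by simp
  hence "poly_at p a (smult (- l) g + pCons 0 g) = 0" using f(2) by simp
  hence "scl (- l) b + conv G a b = 0"
    unfolding poly_at_add_smult poly_at_pCons by (simp add: b_def scl_simps)
  hence ab: "conv G a b = scl l b" by (simp add: fun_eq_iff scl_def)
  obtain h where h: "adj G b = poly_at p a h" using adj_poly_at pf a b_def by blast
  define m where "m = poly h l"
  have m: "conv G (adj G b) b = scl m b" unfolding h m_def by (rule poly_at_conv[OF pb ab])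
  have m0: "m \<noteq> 0"
    using adj_conv_nonzero[OF bf] b0 m by (auto simp: b_def scl_simps)
  \<comment> \<open>The factor makes \<open>adj G q\<close> times \<open>q\<close> equal to
    \<open>q\<close>, the scalars combining to \<open>m / (m * cnj m)\<close>. Self-adjointness then
    follows, because a product of this form is self-adjoint.\<close>
  define q where "q = scl (1 / cnj m) b"
  have qq: "conv G (adj G q) q = q" using m0 by (simp add: q_def m scl_simps)
  have qf: "q \<in> falg G" using bf by (simp add: q_def)
  have "adj G q = adj G (conv G (adj G q) q)" by (simp only: qq)
  also have "\<dots> = conv G (adj G q) q" by (simp only: adj_conv adj_adj[OF qf])
  finally have "adj G q = q" by (simp only: qq)
  hence "projection G q" using qq qf by (simp add: projection_def)
  moreover have "q \<noteq> 0"
  proof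
    assume "q = 0"
    hence "b = 0" using m0 by (simp add: q_def scl_def fun_eq_iff)
    thus False using b0 by (simp add: b_def)
  qed
  moreover have "conv G p q = q" by (simp add: q_def pb)
  moreover have "conv G a q = scl l q" by (simp add: q_def ab scl_simps mult.commute)
  ultimately show ?thesis using that by blast
qed

text \<open>A corner element \<open>p f p\<close> that is not a multiple of \<open>p\<close> has a
  self-adjoint part that is not one either. The spectral projection \<open>q\<close> of that part is
  proper, since \<open>q = p\<close> would make the part equal to \<open>l p\<close>.\<close>

lemma proper_subprojection:
  assumes p: "projection G p" "p \<noteq> 0" and nm: "\<not> minimal_projection G p"
  obtains q where "projection G q" "q \<noteq> 0" "q \<noteq> p" "conv G p q = q" "conv G q p = q"
proof -
  have pf: "p \<in> falg G" "adj G p = p" "conv G p p = p" using p by (simp_all add: projection_def)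
  obtain f where "f \<in> falg G" and f: "\<And>c. conv G p (conv G f p) \<noteq> scl c p"
    using p nm unfolding minimal_projection_def by blast
  define b where "b = conv G p (conv G f p)"
  have bf: "b \<in> falg G" by (simp add: b_def)
  have pb: "conv G p b = b" by (simp add: b_def conv_assoc[symmetric] pf)
  have bp: "conv G b p = b" by (simp add: b_def conv_assoc pf)
  have pb': "conv G p (adj G b) = adj G b" using arg_cong[OF bp, of "adj G"] by (simp add: adj_conv pf)
  have bp': "conv G (adj G b) p = adj G b" using arg_cong[OF pb, of "adj G"] by (simp add: adj_conv pf)
  \<comment> \<open>Up to scalars, \<open>a1\<close> and \<open>a2\<close> are the real and
    imaginary parts of \<open>b\<close>, with \<open>b = (a1 - \<i> a2) / 2\<close>.\<close>
  define a1 where "a1 = b + adj G b"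
  define a2 where "a2 = scl \<i> (b - adj G b)"
  have "\<exists>a\<in>{a1, a2}. \<forall>c. a \<noteq> scl c p"
  proof (rule ccontr)
    assume "\<not> ?thesis"
    then obtain c d where "a1 = scl c p" "a2 = scl d p" by blast
    hence c: "b x + adj G b x = c * p x" and d: "\<i> * (b x - adj G b x) = d * p x" for x
      by (auto simp: a1_def a2_def scl_def fun_eq_iff minus_apply)
    have "b x = (c - \<i> * d) / 2 * p x" for x
    proof -
      have "2 * b x = (b x + adj G b x) - \<i> * (\<i> * (b x - adj G b x))" by (simp flip: mult.assoc)
      also have "\<dots> = (c - \<i> * d) * p x" unfolding c d by (simp add: algebra_simps)
      finally show ?thesis by (simp add: mult.commute)
    qed
    hence "b = scl ((c - \<i> * d) / 2) p" by (simp add: scl_def fun_eq_iff)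
    thus False using f by (simp add: b_def)
  qed
  then obtain a where a: "a \<in> {a1, a2}" and na: "\<And>c. a \<noteq> scl c p" by blast
  have "scl (- \<i>) (adj G b - b) = scl \<i> (b - adj G b)"
    by (simp add: scl_def fun_eq_iff minus_apply algebra_simps)
  hence af: "a \<in> falg G" "adj G a = a" "conv G p a = a" "conv G a p = a"
    using a bf by (auto simp: a1_def a2_def pb bp pb' bp' adj_adj add.commute)
  obtain q l where q: "projection G q" "q \<noteq> 0" "conv G p q = q" "conv G a q = scl l q"
    using spectral_projection[OF p af] by blast
  have "conv G q p = q"
    using arg_cong[OF q(3), of "adj G"] q(1) pf(2) by (simp add: adj_conv projection_def)
  moreover have "q \<noteq> p" using q(4) af(4) na by auto
  ultimately show ?thesis using that q by blast
qed

text \<open>Strong induction on the dimension \<open>card (carrier G) * p \<one>\<close>. A proper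
  subprojection \<open>q\<close> splits it into the dimensions of \<open>q\<close> and
  \<open>p - q\<close>, both positive because a nonzero projection has positive value at
  \<open>\<one>\<close>.\<close>

lemma projection_decomposition:
  assumes "projection G p"
  shows "\<exists>qs. (\<forall>q\<in>set qs. minimal_projection G q) \<and> (\<forall>x. p x = (\<Sum>q\<leftarrow>qs. q x))"
proof -
  have trace: "\<exists>n. of_nat (card (carrier G)) * p \<one> = of_nat n" if "projection G p" for p
    using projection_trace_nat[OF that] by (auto elim: Nats_cases)
  have "\<exists>qs. (\<forall>q\<in>set qs. minimal_projection G q) \<and> (\<forall>x. p x = (\<Sum>q\<leftarrow>qs. q x))"
    if "projection G p" "of_nat (card (carrier G)) * p \<one> = of_nat n" for n p
    using that
  proof (induction n arbitrary: p rule: less_induct)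
    case (less n)
    show ?case
    proof (cases "p = 0 \<or> minimal_projection G p")
      case True
      thus ?thesis
      proof
        assume "p = 0"
        thus ?thesis by (intro exI[of _ "[]"]) simp
      next
        assume "minimal_projection G p"
        thus ?thesis by (intro exI[of _ "[p]"]) simp
      qed
    next
      case False
      then obtain q where q: "projection G q" "q \<noteq> 0" "q \<noteq> p" "conv G p q = q" "conv G q p = q"
        using proper_subprojection[OF less.prems(1)] by blast
      have r: "projection G (p - q)" by (rule projection_sub) (use less.prems q in simp_all)
      have r0: "p - q \<noteq> 0" using q(3) by auto
      obtain i j where i: "of_nat (card (carrier G)) * q \<one> = of_nat i"
        and j: "of_nat (card (carrier G)) * (p - q) \<one> = of_nat j"
        using trace q(1) r by metis
      have "of_nat n = (of_nat (i + j) :: complex)"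
        using less.prems(2) i j by (simp add: minus_apply algebra_simps)
      hence n: "n = i + j" by (simp only: of_nat_eq_iff)
      have c0: "complex_of_nat (card (carrier G)) \<noteq> 0" using one_closed by auto
      have "q \<one> \<noteq> 0" "(p - q) \<one> \<noteq> 0"
        using projection_at_one(2)[OF q(1,2)] projection_at_one(2)[OF r r0]
        by (metis less_irrefl zero_complex.simps(1))+
      hence "complex_of_nat i \<noteq> 0" "complex_of_nat j \<noteq> 0"
        unfolding i[symmetric] j[symmetric] using c0 by (metis mult_eq_0_iff)+
      hence ij: "i < n" "j < n" unfolding n by auto
      from less.IH[OF ij(1) q(1) i] less.IH[OF ij(2) r j] obtain qs rs where
        m: "\<forall>u\<in>set qs. minimal_projection G u" "\<forall>u\<in>set rs. minimal_projection G u"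
        and s: "\<And>x. q x = (\<Sum>u\<leftarrow>qs. u x)" "\<And>x. (p - q) x = (\<Sum>u\<leftarrow>rs. u x)" by metis
      have "p x = (\<Sum>u\<leftarrow>qs @ rs. u x)" for x
      proof -
        have "p x = q x + (p - q) x" by (simp add: minus_apply)
        thus ?thesis by (simp only: s map_append sum_list_append)
      qed
      thus ?thesis using m by (intro exI[of _ "qs @ rs"]) auto
    qed
  qed
  thus ?thesis using trace assms by blast
qed

text \<open>This decomposes the regular representation: each irreducible character \<chi> occurs
  \<chi>(1) times among the \<open>q i\<close>, which supplies the weights when the lemma is applied
  to \<open>H\<close> in \<open>kernel_sum_nonneg\<close>.\<close>

lemma one_decomposition:
  "\<exists>n q. (\<forall>i < (n :: nat). minimal_projection G (q i)) \<and> (\<forall>x. point_mass \<one> x = (\<Sum>i<n. q i x))"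
proof -
  obtain qs where qs: "\<forall>q\<in>set qs. minimal_projection G q"
    "\<forall>x. point_mass \<one> x = (\<Sum>q\<leftarrow>qs. q x)"
    using projection_decomposition[OF projection_one] by blast
  have "point_mass \<one> x = (\<Sum>i<length qs. (qs ! i) x)" for x
    using qs(2) by (simp add: sum_list_sum_nth atLeast0LessThan)
  with qs(1) show ?thesis by (intro exI[of _ "length qs"] exI[of _ "\<lambda>i. qs ! i"]) auto
qed

section \<open>Class functions\<close>

lemma class_sum_one: "class_sum G f \<one> = of_nat (card (carrier G)) * f \<one>"
  by (simp add: class_sum_def)

lemma class_sum_conj:
  assumes "y \<in> carrier G" "z \<in> carrier G"
  shows "class_sum G f (z \<otimes> y \<otimes> inv z) = class_sum G f y"
proof -
  have "class_sum G f (z \<otimes> y \<otimes> inv z) = (\<Sum>x\<in>carrier G. f ((x \<otimes> z) \<otimes> y \<otimes> inv (x \<otimes> z)))"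
    unfolding class_sum_def by (rule sum.cong) (use assms in \<open>simp_all add: m_assoc inv_mult_group\<close>)
  also have "\<dots> = class_sum G f y" unfolding class_sum_def by (rule sum_mult_right) (fact assms)
  finally show ?thesis .
qed

lemma class_sum_inv:
  assumes "projection G p" "y \<in> carrier G"
  shows "class_sum G p (inv y) = cnj (class_sum G p y)"
proof -
  have "class_sum G p (inv y) = (\<Sum>x\<in>carrier G. p (inv (x \<otimes> y \<otimes> inv x)))"
    unfolding class_sum_def
    by (rule sum.cong) (use assms(2) in \<open>simp_all add: m_assoc inv_mult_group\<close>)
  also have "\<dots> = (\<Sum>x\<in>carrier G. cnj (p (x \<otimes> y \<otimes> inv x)))"
    by (intro sum.cong refl projection_inv[OF assms(1)]) (use assms(2) in auto)
  finally show ?thesis by (simp add: class_sum_def)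
qed

lemma pairing_class_sum: "pairing G f g = (\<Sum>y\<in>carrier G. class_sum G f y * g (inv y))"
  unfolding pairing_def class_sum_def sum_distrib_right by (rule sum.swap)

text \<open>\<open>class_sum G p\<close> adds up the conjugates of \<open>p\<close>, and a class
  function has the same sum against each of them.\<close>

lemma class_function_inner:
  assumes F: "\<And>y z. y \<in> carrier G \<Longrightarrow> z \<in> carrier G \<Longrightarrow> F (z \<otimes> y \<otimes> inv z) = F y"
    and p: "projection G p"
  shows "(\<Sum>y\<in>carrier G. F y * cnj (class_sum G p y))
    = of_nat (card (carrier G)) * (\<Sum>y\<in>carrier G. F y * p (inv y))"
proof -
  have "(\<Sum>y\<in>carrier G. F y * cnj (class_sum G p y)) = (\<Sum>y\<in>carrier G. F y * class_sum G p (inv y))"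
    by (intro sum.cong refl) (simp add: class_sum_inv[OF p])
  also have "\<dots> = (\<Sum>y\<in>carrier G. \<Sum>x\<in>carrier G. F y * p (x \<otimes> inv y \<otimes> inv x))"
    by (simp add: class_sum_def sum_distrib_left)
  also have "\<dots> = (\<Sum>x\<in>carrier G. \<Sum>y\<in>carrier G. F y * p (x \<otimes> inv y \<otimes> inv x))"
    by (rule sum.swap)
  also have "\<dots> = (\<Sum>x\<in>carrier G. \<Sum>y\<in>carrier G. F y * p (inv y))"
  proof (rule sum.cong[OF refl])
    fix x assume x: "x \<in> carrier G"
    have Fx': "F (x \<otimes> (y \<otimes> inv x)) = F y" if "y \<in> carrier G" for y
      using F[OF that x] x that by (simp add: m_assoc)
    show "(\<Sum>y\<in>carrier G. F y * p (x \<otimes> inv y \<otimes> inv x)) = (\<Sum>y\<in>carrier G. F y * p (inv y))"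
      by (rule sum.reindex_bij_witness[of _ "\<lambda>y. inv x \<otimes> y \<otimes> x" "\<lambda>y. x \<otimes> y \<otimes> inv x"])
        (use x Fx' in \<open>simp_all add: m_assoc inv_mult_group\<close>)
  qed
  finally show ?thesis by simp
qed

text \<open>The squared norm of the difference of \<open>p\<close> and its translate by \<open>g\<close> is \<open>2 Re (p 1 - p g)\<close>.\<close>

lemma projection_translate:
  assumes p: "projection G p" and g: "g \<in> carrier G"
  shows "Re (p g) \<le> Re (p \<one>)"
    and "Re (p g) = Re (p \<one>) \<Longrightarrow> x \<in> carrier G \<Longrightarrow> p (g \<otimes> x) = p x"
proof -
  have "of_real (\<Sum>x\<in>carrier G. (cmod (p (g \<otimes> x) - p x))\<^sup>2)
      = (\<Sum>x\<in>carrier G. p (g \<otimes> x) * cnj (p (g \<otimes> x))) + (\<Sum>x\<in>carrier G. p x * cnj (p x))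
        - (\<Sum>x\<in>carrier G. p (g \<otimes> x) * cnj (p x)) - cnj (\<Sum>x\<in>carrier G. p (g \<otimes> x) * cnj (p x))"
    unfolding of_real_sum complex_norm_square cnj_sum sum_subtractf[symmetric] sum.distrib[symmetric]
    by (rule sum.cong) (simp_all add: algebra_simps)
  also have "(\<Sum>x\<in>carrier G. p (g \<otimes> x) * cnj (p (g \<otimes> x))) = (\<Sum>x\<in>carrier G. p x * cnj (p x))"
    by (rule sum_mult_left[OF g])
  also have "(\<Sum>x\<in>carrier G. p x * cnj (p x)) = p \<one>"
    unfolding projection_at_one(1)[OF p] of_real_sum complex_norm_square ..
  also have "(\<Sum>x\<in>carrier G. p (g \<otimes> x) * cnj (p x)) = (\<Sum>x\<in>carrier G. p (g \<otimes> x) * p (inv x))"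
    by (intro sum.cong refl) (simp add: projection_inv[OF p])
  also have "\<dots> = (\<Sum>z\<in>carrier G. p z * p (inv z \<otimes> g))"
    by (rule sum.reindex_bij_witness[of _ "\<lambda>z. inv g \<otimes> z" "\<lambda>x. g \<otimes> x"])
      (use g in \<open>simp_all add: m_assoc inv_mult_group\<close>)
  also have "\<dots> = p g" by (rule projection_conv[OF p g])
  finally have "complex_of_real (\<Sum>x\<in>carrier G. (cmod (p (g \<otimes> x) - p x))\<^sup>2) = p \<one> + p \<one> - p g - cnj (p g)" .
  from arg_cong[OF this, of Re]
  have *: "(\<Sum>x\<in>carrier G. (cmod (p (g \<otimes> x) - p x))\<^sup>2) = 2 * Re (p \<one>) - 2 * Re (p g)"
    by (simp only: Re_complex_of_real) simp
  have "(\<Sum>x\<in>carrier G. (cmod (p (g \<otimes> x) - p x))\<^sup>2) \<ge> 0" by (intro sum_nonneg) simp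
  thus "Re (p g) \<le> Re (p \<one>)" using * by simp
  assume "Re (p g) = Re (p \<one>)" "x \<in> carrier G"
  moreover from this have "(\<Sum>x\<in>carrier G. (cmod (p (g \<otimes> x) - p x))\<^sup>2) = 0" using * by simp
  ultimately show "p (g \<otimes> x) = p x" by (subst (asm) sum_nonneg_eq_0_iff) auto
qed

text \<open>Extension by zero embeds the algebra of \<open>K\<close> in that of \<open>G\<close>,
  respecting product and involution. As elements vanish off their carrier, \<open>r\<close> is the
  same function in both, and inducing its character only means taking \<open>class_sum\<close> over
  \<open>G\<close>.\<close>

lemma projection_subgroup:
  assumes K: "subgroup K G" and r: "projection (G\<lparr>carrier := K\<rparr>) r"
  shows "projection G r"
proof -
  interpret K: subgroup K G by fact
  have r0: "x \<notin> K \<Longrightarrow> r x = 0" for x using r by (simp add: projection_def falg_def)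
  have inv: "x \<in> K \<Longrightarrow> inv\<^bsub>G\<lparr>carrier := K\<rparr>\<^esub> x = inv x" for x
    using K by (simp add: m_inv_consistent)
  have adj: "adj (G\<lparr>carrier := K\<rparr>) r x = r x" "conv (G\<lparr>carrier := K\<rparr>) r r x = r x" for x
    using r by (simp_all add: projection_def)
  have "r \<in> falg G" using r0 K.subset by (auto simp: falg_def)
  moreover have "adj G r = r"
  proof
    fix x
    show "adj G r x = r x"
    proof (cases "x \<in> K")
      case True
      thus ?thesis using adj(1)[of x] by (simp add: adj_def inv)
    next
      case False
      have "inv x \<notin> K" if "x \<in> carrier G" using K.m_inv_closed[of "inv x"] that False by auto
      thus ?thesis using False by (auto simp: adj_def r0)
    qed
  qed
  moreover have "conv G r r = r"
  proof
    fix x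
    have s: "(\<Sum>y\<in>carrier G. r y * r (inv y \<otimes> x)) = (\<Sum>y\<in>K. r y * r (inv y \<otimes> x))"
      by (rule sum.mono_neutral_right) (use K.subset r0 in auto)
    show "conv G r r x = r x"
    proof (cases "x \<in> K")
      case True
      have "(\<Sum>y\<in>K. r y * r (inv y \<otimes> x)) = r x"
        using adj(2)[of x] True by (simp add: conv_def inv cong: sum.cong)
      thus ?thesis using True K.subset by (auto simp: conv_def s)
    next
      case False
      have "(\<Sum>y\<in>K. r y * r (inv y \<otimes> x)) = 0" if x: "x \<in> carrier G"
      proof (rule sum.neutral, rule ballI)
        fix y assume y: "y \<in> K"
        have "inv y \<otimes> x \<notin> K"
        proof
          assume "inv y \<otimes> x \<in> K"
          hence "y \<otimes> (inv y \<otimes> x) \<in> K" using y by blast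
          thus False using False y x K.subset by (auto simp: subset_iff)
        qed
        thus "r y * r (inv y \<otimes> x) = 0" by (simp add: r0)
      qed
      thus ?thesis using False by (simp add: conv_def s r0)
    qed
  qed
  ultimately show ?thesis by (simp add: projection_def)
qed

lemma projection_uniform_carrier: "projection G (uniform (carrier G))"
proof -
  have "complex_of_nat (card (carrier G)) \<noteq> 0" using one_closed by auto
  thus ?thesis
    by (auto simp: projection_def falg_def adj_def conv_def uniform_def fun_eq_iff)
qed

end

section \<open>Frobenius's theorem\<close>

locale frobenius_group = fin_group +
  fixes H
  assumes complement: "frobenius_complement G H"
begin

section \<open>Elementary structure of a Frobenius group\<close>

abbreviation N where "N \<equiv> frobenius_kernel G H"

lemma subgroup_H: "subgroup H G"
  using complement by (simp add: frobenius_complement_def)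

sublocale H: subgroup H G by (rule subgroup_H)

lemma finite_H [simp, intro]: "finite H"
  using H.subset finite_carrier by (rule finite_subset)

text \<open>Malnormality of \<open>H\<close>, the form in which the disjointness condition enters
  everything below.\<close>

lemma conj_in_H:
  assumes "x \<in> carrier G" "h \<in> H" "h \<noteq> \<one>" "x \<otimes> h \<otimes> inv x \<in> H"
  shows "x \<in> H"
proof (rule ccontr)
  assume "x \<notin> H"
  hence "H \<inter> conj_set G x H = {\<one>}" using complement assms(1) by (simp add: frobenius_complement_def)
  moreover have "x \<otimes> h \<otimes> inv x \<in> conj_set G x H" using assms(2) by (auto simp: conj_set_def)
  ultimately have "x \<otimes> h \<otimes> inv x = \<one>" using assms(4) by blast
  hence "inv x \<otimes> (x \<otimes> h \<otimes> inv x) \<otimes> x = \<one>" using assms(1) by simp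
  thus False using assms(1-3) by (simp add: m_assoc)
qed

lemma kernel_iff:
  "g \<in> N \<longleftrightarrow> g = \<one> \<or> g \<in> carrier G \<and> (\<forall>x\<in>carrier G. inv x \<otimes> g \<otimes> x \<notin> H)"
proof -
  have "g \<in> conj_set G x H \<longleftrightarrow> inv x \<otimes> g \<otimes> x \<in> H" if "x \<in> carrier G" "g \<in> carrier G" for x
  proof
    assume "inv x \<otimes> g \<otimes> x \<in> H"
    moreover have "g = x \<otimes> (inv x \<otimes> g \<otimes> x) \<otimes> inv x" using that by (simp add: m_assoc)
    ultimately show "g \<in> conj_set G x H" unfolding conj_set_def by blast
  next
    assume "g \<in> conj_set G x H"
    then obtain h where "h \<in> H" "g = x \<otimes> h \<otimes> inv x" by (auto simp: conj_set_def)
    thus "inv x \<otimes> g \<otimes> x \<in> H" using that by (simp add: m_assoc)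
  qed
  thus ?thesis by (auto simp: frobenius_kernel_def)
qed

lemma one_kernel [simp]: "\<one> \<in> N"
  by (simp add: kernel_iff)

lemma kernel_subset: "N \<subseteq> carrier G"
  by (auto simp: kernel_iff)

lemma kernel_inv:
  assumes "g \<in> N" shows "inv g \<in> N"
proof -
  have g: "g \<in> carrier G" using assms kernel_subset by blast
  have "inv x \<otimes> inv g \<otimes> x \<notin> H" if "x \<in> carrier G" "inv x \<otimes> g \<otimes> x \<notin> H" for x
    using H.m_inv_closed[of "inv x \<otimes> inv g \<otimes> x"] that g by (auto simp: inv_mult_group m_assoc)
  thus ?thesis using assms g by (auto simp: kernel_iff)
qed

lemma kernel_conj:
  assumes "g \<in> N" "x \<in> carrier G" shows "x \<otimes> g \<otimes> inv x \<in> N"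
proof (cases "g = \<one>")
  case True
  thus ?thesis using assms(2) by simp
next
  case False
  have g: "g \<in> carrier G" using assms kernel_subset by blast
  have "inv y \<otimes> (x \<otimes> g \<otimes> inv x) \<otimes> y \<notin> H" if y: "y \<in> carrier G" for y
  proof -
    have "inv (inv x \<otimes> y) \<otimes> g \<otimes> (inv x \<otimes> y) \<notin> H"
      using assms False y by (auto simp: kernel_iff)
    thus ?thesis using y g assms(2) by (simp add: inv_mult_group m_assoc)
  qed
  thus ?thesis using g assms(2) by (auto simp: kernel_iff)
qed

lemma kernel_inter_H: "N \<inter> H = {\<one>}"
proof -
  have "h = \<one>" if "h \<in> N" "h \<in> H" for h
  proof (rule ccontr)
    assume "h \<noteq> \<one>"
    hence "inv \<one> \<otimes> h \<otimes> \<one> \<notin> H" using that(1) one_closed unfolding kernel_iff by blast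
    thus False using that(2) by simp
  qed
  thus ?thesis by auto
qed

lemma conj_not_kernel:
  assumes "h \<in> H" "h \<noteq> \<one>" "x \<in> carrier G"
  shows "x \<otimes> h \<otimes> inv x \<in> carrier G - N"
proof -
  have "h \<in> N" if "x \<otimes> h \<otimes> inv x \<in> N"
    using kernel_conj[OF that, of "inv x"] assms by (simp add: m_assoc)
  thus ?thesis using assms kernel_inter_H by auto
qed

lemma not_kernel:
  assumes "g \<in> carrier G - N"
  obtains x h where "x \<in> carrier G" "h \<in> H" "h \<noteq> \<one>" "g = x \<otimes> h \<otimes> inv x"
proof -
  obtain x where x: "x \<in> carrier G" "inv x \<otimes> g \<otimes> x \<in> H" using assms by (auto simp: kernel_iff)
  have g: "g = x \<otimes> (inv x \<otimes> g \<otimes> x) \<otimes> inv x" using assms x(1) by (simp add: m_assoc)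
  moreover have "inv x \<otimes> g \<otimes> x \<noteq> \<one>" using g x(1) assms by auto
  ultimately show ?thesis using that x by blast
qed

text \<open>Double counting of the pairs \<open>(x, g)\<close> with \<open>g\<close> outside
  \<open>N\<close> and \<open>inv x \<otimes> g \<otimes> x\<close> in \<open>H\<close>, weighted by
  \<open>F g\<close>: each \<open>x\<close> contributes the sum over \<open>H - {\<one>}\<close>,
  and each \<open>g\<close> occurs with exactly \<open>card H\<close> values of
  \<open>x\<close>.\<close>

lemma sum_conjugates:
  fixes F :: "'a \<Rightarrow> 'c :: comm_semiring_1"
  assumes F: "\<And>y z. y \<in> carrier G \<Longrightarrow> z \<in> carrier G \<Longrightarrow> F (z \<otimes> y \<otimes> inv z) = F y"
  shows "of_nat (card (carrier G)) * (\<Sum>h\<in>H - {\<one>}. F h) = of_nat (card H) * (\<Sum>g\<in>carrier G - N. F g)"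
proof -
  have "of_nat (card (carrier G)) * (\<Sum>h\<in>H - {\<one>}. F h)
      = (\<Sum>x\<in>carrier G. \<Sum>h\<in>H - {\<one>}. F h)" by simp
  also have "\<dots> = (\<Sum>x\<in>carrier G. \<Sum>g | g \<in> carrier G - N \<and> inv x \<otimes> g \<otimes> x \<in> H. F g)"
  proof (rule sum.cong[OF refl])
    fix x assume x: "x \<in> carrier G"
    show "(\<Sum>h\<in>H - {\<one>}. F h) = (\<Sum>g | g \<in> carrier G - N \<and> inv x \<otimes> g \<otimes> x \<in> H. F g)"
    proof (rule sum.reindex_bij_witness[of _ "\<lambda>g. inv x \<otimes> g \<otimes> x" "\<lambda>h. x \<otimes> h \<otimes> inv x"])
      fix h assume h: "h \<in> H - {\<one>}"
      show "inv x \<otimes> (x \<otimes> h \<otimes> inv x) \<otimes> x = h" using h x by (simp add: m_assoc)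
      thus "x \<otimes> h \<otimes> inv x \<in> {g \<in> carrier G - N. inv x \<otimes> g \<otimes> x \<in> H}"
        using conj_not_kernel[of h x] h x by auto
      show "F (x \<otimes> h \<otimes> inv x) = F h" using F h x by auto
    next
      fix g assume g: "g \<in> {g \<in> carrier G - N. inv x \<otimes> g \<otimes> x \<in> H}"
      show *: "x \<otimes> (inv x \<otimes> g \<otimes> x) \<otimes> inv x = g" using g x by (simp add: m_assoc)
      have "inv x \<otimes> g \<otimes> x \<noteq> \<one>" using * g x by auto
      thus "inv x \<otimes> g \<otimes> x \<in> H - {\<one>}" using g by auto
    qed
  qed
  also have "\<dots> = (\<Sum>x\<in>carrier G. \<Sum>g\<in>carrier G - N. if inv x \<otimes> g \<otimes> x \<in> H then F g else 0)"
    by (intro sum.cong[OF refl] sum.inter_filter) simp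
  also have "\<dots> = (\<Sum>g\<in>carrier G - N. \<Sum>x\<in>carrier G. if inv x \<otimes> g \<otimes> x \<in> H then F g else 0)"
    by (rule sum.swap)
  also have "\<dots> = (\<Sum>g\<in>carrier G - N. of_nat (card H) * F g)"
  proof (rule sum.cong[OF refl])
    fix g assume "g \<in> carrier G - N"
    then obtain a h where a: "a \<in> carrier G" and h: "h \<in> H" "h \<noteq> \<one>" and g: "g = a \<otimes> h \<otimes> inv a"
      using not_kernel by blast
    \<comment> \<open>Malnormality confines \<open>x\<close> to the left coset of \<open>H\<close>
      through \<open>a\<close>.\<close>
    have "{x \<in> carrier G. inv x \<otimes> g \<otimes> x \<in> H} = (\<lambda>k. a \<otimes> k) ` H"
    proof (intro equalityI subsetI)
      fix x assume "x \<in> {x \<in> carrier G. inv x \<otimes> g \<otimes> x \<in> H}"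
      hence x: "x \<in> carrier G" "inv x \<otimes> g \<otimes> x \<in> H" by auto
      have "(inv x \<otimes> a) \<otimes> h \<otimes> inv (inv x \<otimes> a) \<in> H"
        using x a h by (simp add: g m_assoc inv_mult_group)
      hence "inv x \<otimes> a \<in> H" by (rule conj_in_H[rotated 3]) (use x(1) a h in auto)
      hence "inv (inv x \<otimes> a) \<in> H" by simp
      moreover have "x = a \<otimes> inv (inv x \<otimes> a)" using x a by (simp add: inv_mult_group)
      ultimately show "x \<in> (\<lambda>k. a \<otimes> k) ` H" by blast
    next
      fix x assume "x \<in> (\<lambda>k. a \<otimes> k) ` H"
      then obtain k where k: "k \<in> H" "x = a \<otimes> k" by blast
      have "inv x \<otimes> g \<otimes> x = inv k \<otimes> h \<otimes> k"
        using k a h by (simp add: g m_assoc inv_mult_group)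
      thus "x \<in> {x \<in> carrier G. inv x \<otimes> g \<otimes> x \<in> H}" using k a h by auto
    qed
    moreover have "inj_on (\<lambda>k. a \<otimes> k) H"
      by (rule inj_onI) (use a H.subset in \<open>metis inv_cancel_left(1) subsetD\<close>)
    ultimately have "card {x \<in> carrier G. inv x \<otimes> g \<otimes> x \<in> H} = card H"
      by (simp add: card_image)
    thus "(\<Sum>x\<in>carrier G. if inv x \<otimes> g \<otimes> x \<in> H then F g else 0) = of_nat (card H) * F g"
      by (simp flip: sum.inter_filter)
  qed
  finally show ?thesis by (simp add: sum_distrib_left)
qed

lemma card_H_pos: "card H > 0"
  unfolding card_gt_0_iff using H.one_closed finite_H by blast

text \<open>The constant function 1 in \<open>sum_conjugates\<close> gives
  \<open>|G| (|H| - 1) = |H| (|G| - |N|)\<close>; working over the integers keeps the subtractions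
  exact.\<close>

lemma card_kernel: "card (carrier G) = card H * card N"
proof -
  have "int (card (carrier G)) * (\<Sum>h\<in>H - {\<one>}. 1) = int (card H) * (\<Sum>g\<in>carrier G - N. 1)"
    by (rule sum_conjugates) simp
  moreover have "int (card (H - {\<one>})) = int (card H) - 1"
    using card_Diff_singleton[of \<one> H] card_H_pos by (simp add: of_nat_diff)
  moreover have "int (card (carrier G - N)) = int (card (carrier G)) - int (card N)"
    using card_Diff_subset[of N "carrier G"] kernel_subset finite_subset[OF kernel_subset]
      card_mono[OF finite_carrier kernel_subset] by (simp add: of_nat_diff)
  ultimately have "int (card (carrier G)) = int (card H * card N)" by (simp add: algebra_simps)
  thus ?thesis by (simp only: of_nat_eq_iff)
qed

text \<open>The elements outside \<open>N\<close> are handled by \<open>sum_conjugates\<close>, with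
  \<open>card_kernel\<close> cancelling \<open>card H\<close>. The identity serves twice: for the
  norm in \<open>extension_norm\<close> and for the count in \<open>centralizer_sum\<close>.\<close>

lemma sum_frobenius:
  fixes F :: "'a \<Rightarrow> 'c :: field_char_0"
  assumes F: "\<And>y z. y \<in> carrier G \<Longrightarrow> z \<in> carrier G \<Longrightarrow> F (z \<otimes> y \<otimes> inv z) = F y"
  shows "(\<Sum>g\<in>carrier G. F g) = F \<one> + (\<Sum>g\<in>N - {\<one>}. F g) + of_nat (card N) * (\<Sum>h\<in>H - {\<one>}. F h)"
proof -
  have "of_nat (card H) * (of_nat (card N) * (\<Sum>h\<in>H - {\<one>}. F h)) = of_nat (card H) * (\<Sum>g\<in>carrier G - N. F g)"
    using sum_conjugates[of F, OF F] by (simp add: card_kernel mult.assoc)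
  hence "of_nat (card N) * (\<Sum>h\<in>H - {\<one>}. F h) = (\<Sum>g\<in>carrier G - N. F g)"
    using card_H_pos by (subst (asm) mult_cancel_left) (metis less_irrefl of_nat_eq_0_iff)
  moreover have "(\<Sum>g\<in>carrier G. F g) = (\<Sum>g\<in>N. F g) + (\<Sum>g\<in>carrier G - N. F g)"
    using sum.subset_diff[OF kernel_subset finite_carrier, of F] by (simp add: add.commute)
  moreover have "(\<Sum>g\<in>N. F g) = F \<one> + (\<Sum>g\<in>N - {\<one>}. F g)"
    by (rule sum.remove) (auto intro: finite_subset[OF kernel_subset])
  ultimately show ?thesis by simp
qed

section \<open>Extending characters of the complement\<close>

abbreviation GH where "GH \<equiv> G\<lparr>carrier := H\<rparr>"

lemma fin_group_H: "fin_group GH"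
proof -
  interpret GH: group GH by (rule H.subgroup_is_group) (rule is_group)
  show ?thesis by unfold_locales simp
qed

lemmas GH_class_sum_one = fin_group.class_sum_one[OF fin_group_H, simplified]
  and GH_class_sum_conj = fin_group.class_sum_conj[OF fin_group_H, simplified]
  and GH_class_function_inner = fin_group.class_function_inner[OF fin_group_H, simplified]
  and GH_minimal_pairing_self = fin_group.minimal_pairing_self[OF fin_group_H]
  and GH_pairing_class_sum = fin_group.pairing_class_sum[OF fin_group_H, simplified]
  and GH_projection_trace_nat = fin_group.projection_trace_nat[OF fin_group_H, simplified]
  and GH_projection_at_one = fin_group.projection_at_one[OF fin_group_H, simplified]
  and GH_projection_uniform_carrier = fin_group.projection_uniform_carrier[OF fin_group_H, simplified]
  and GH_one_decomposition = fin_group.one_decomposition[OF fin_group_H, simplified]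

lemma inv_GH: "h \<in> H \<Longrightarrow> inv\<^bsub>GH\<^esub> h = inv h"
  using subgroup_H by (simp add: m_inv_consistent)

text \<open>Only conjugators in \<open>H\<close> keep a nontrivial \<open>h\<close> inside the
  support of \<open>f\<close>, and no conjugate of a nontrivial \<open>g\<close> in \<open>N\<close>
  reaches \<open>H\<close>. So an induced character restricts to the original on
  \<open>H - {\<one>}\<close> and vanishes on \<open>N - {\<one>}\<close>.\<close>

lemma class_sum_H:
  assumes f: "\<And>x. x \<notin> H \<Longrightarrow> f x = 0"
  shows "h \<in> H \<Longrightarrow> h \<noteq> \<one> \<Longrightarrow> class_sum G f h = class_sum GH f h"
    and "g \<in> N \<Longrightarrow> g \<noteq> \<one> \<Longrightarrow> class_sum G f g = 0"
proof -
  assume h: "h \<in> H" "h \<noteq> \<one>"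
  have "class_sum G f h = (\<Sum>x\<in>H. f (x \<otimes> h \<otimes> inv x))"
    unfolding class_sum_def
    by (rule sum.mono_neutral_right) (use H.subset f conj_in_H[OF _ h] in auto)
  thus "class_sum G f h = class_sum GH f h" by (simp add: class_sum_def inv_GH cong: sum.cong)
next
  assume g: "g \<in> N" "g \<noteq> \<one>"
  have "x \<otimes> g \<otimes> inv x \<notin> H" if x: "x \<in> carrier G" for x
  proof
    assume "x \<otimes> g \<otimes> inv x \<in> H"
    hence "x \<otimes> g \<otimes> inv x = \<one>" using kernel_conj[OF g(1) x] kernel_inter_H by blast
    hence "inv x \<otimes> (x \<otimes> g \<otimes> inv x) \<otimes> x = \<one>" using x by simp
    thus False using x g kernel_subset by (auto simp: m_assoc)
  qed
  thus "class_sum G f g = 0" unfolding class_sum_def by (intro sum.neutral) (simp add: f)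
qed

text \<open>
  The virtual character \<open>Ind \<chi> - \<chi>(1) Ind 1 + \<chi>(1) 1\<close>, where \<open>\<chi>\<close> is the character of \<open>f\<close>.
\<close>

definition extension :: "('a \<Rightarrow> complex) \<Rightarrow> 'a \<Rightarrow> complex" where
  "extension f y = class_sum G f y + of_nat (card H) * f \<one> * (1 - class_sum G (uniform H) y)"

lemma extension_conj:
  "y \<in> carrier G \<Longrightarrow> z \<in> carrier G \<Longrightarrow> extension f (z \<otimes> y \<otimes> inv z) = extension f y"
  by (simp add: extension_def class_sum_conj)

text \<open>The induced trivial character is 1 on \<open>H - {\<one>}\<close>, 0 on
  \<open>N - {\<one>}\<close> and \<open>|G| / |H|\<close> at \<open>\<one>\<close>. The correction
  term thus vanishes on the first set, is constant on the second, and at \<open>\<one>\<close> cuts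
  the degree \<open>|G| f(1)\<close> down to \<open>|H| f(1)\<close>.\<close>

lemma extension_values:
  assumes f: "\<And>x. x \<notin> H \<Longrightarrow> f x = 0"
  shows "extension f \<one> = of_nat (card H) * f \<one>"
    and "h \<in> H \<Longrightarrow> h \<noteq> \<one> \<Longrightarrow> extension f h = class_sum GH f h"
    and "g \<in> N \<Longrightarrow> extension f g = of_nat (card H) * f \<one>"
proof -
  have c: "complex_of_nat (card H) \<noteq> 0" using card_H_pos by (metis less_irrefl of_nat_eq_0_iff)
  have u: "uniform H x = 0" if "x \<notin> H" for x using that by (simp add: uniform_def)
  show one: "extension f \<one> = of_nat (card H) * f \<one>"
    using c by (simp add: extension_def class_sum_one uniform_def field_simps)
  show "extension f g = of_nat (card H) * f \<one>" if "g \<in> N"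
    using one class_sum_H(2)[of f g, OF f that] class_sum_H(2)[of "uniform H" g, OF u that]
    by (cases "g = \<one>") (auto simp: extension_def)
  assume h: "h \<in> H" "h \<noteq> \<one>"
  have "class_sum GH (uniform H) h = 1"
    using c h by (simp add: class_sum_def inv_GH uniform_def cong: sum.cong)
  thus "extension f h = class_sum GH f h"
    using class_sum_H(1)[of f h, OF f h] class_sum_H(1)[of "uniform H" h, OF u h]
    by (simp add: extension_def)
qed

text \<open>Since the extension is constant on \<open>N\<close>, \<open>sum_frobenius\<close> turns
  the sum over \<open>G\<close> into \<open>card N\<close> times the corresponding sum over
  \<open>H\<close>, which is \<open>card H\<close> by irreducibility of \<open>r\<close>.\<close>

lemma extension_norm:
  assumes r: "minimal_projection GH r"
  shows "(\<Sum>y\<in>carrier G. extension r y * cnj (extension r y)) = of_nat (card (carrier G))"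
proof -
  have pr: "projection GH r" using r by (simp add: minimal_projection_def)
  have r0: "r x = 0" if "x \<notin> H" for x using pr that by (simp add: projection_def falg_def)
  have c: "class_sum GH r \<one> = of_nat (card H) * r \<one>" using GH_class_sum_one[of r] by simp
  define F where "F y = extension r y * cnj (extension r y)" for y
  have "(\<Sum>y\<in>carrier G. F y) = F \<one> + (\<Sum>g\<in>N - {\<one>}. F g) + of_nat (card N) * (\<Sum>h\<in>H - {\<one>}. F h)"
    by (rule sum_frobenius) (simp add: F_def extension_conj)
  also have "(\<Sum>g\<in>N - {\<one>}. F g) = (\<Sum>g\<in>N - {\<one>}. F \<one>)"
    by (rule sum.cong) (simp_all add: F_def extension_values(1,3)[of r, OF r0])
  also have "F \<one> + (\<Sum>g\<in>N - {\<one>}. F \<one>) = (\<Sum>g\<in>N. F \<one>)"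
    by (rule sum.remove[symmetric]) (auto intro: finite_subset[OF kernel_subset])
  also have "\<dots> = of_nat (card N) * F \<one>" by simp
  also have "\<dots> + of_nat (card N) * (\<Sum>h\<in>H - {\<one>}. F h)
      = of_nat (card N) * (F \<one> + (\<Sum>h\<in>H - {\<one>}. F h))" by (simp add: algebra_simps)
  also have "F \<one> + (\<Sum>h\<in>H - {\<one>}. F h) = (\<Sum>h\<in>H. F h)"
    by (rule sum.remove[symmetric]) auto
  also have "\<dots> = (\<Sum>h\<in>H. class_sum GH r h * cnj (class_sum GH r h))"
  proof (rule sum.cong[OF refl])
    fix h assume "h \<in> H"
    hence "extension r h = class_sum GH r h"
      by (cases "h = \<one>") (simp_all add: extension_values(1,2)[of r, OF r0] c)
    thus "F h = class_sum GH r h * cnj (class_sum GH r h)" by (simp add: F_def)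
  qed
  also have "\<dots> = of_nat (card H) * (\<Sum>h\<in>H. class_sum GH r h * r (inv\<^bsub>GH\<^esub> h))"
    by (rule GH_class_function_inner) (use pr GH_class_sum_conj in auto)
  also have "(\<Sum>h\<in>H. class_sum GH r h * r (inv\<^bsub>GH\<^esub> h)) = 1"
    using GH_minimal_pairing_self[OF r] by (simp add: GH_pairing_class_sum)
  finally show ?thesis by (simp add: F_def card_kernel mult.commute)
qed

text \<open>The extension is an integer combination of the class sums of three projections of
  \<open>G\<close>, namely \<open>r\<close>, \<open>uniform H\<close> and
  \<open>uniform (carrier G)\<close>, so integrality reduces to \<open>pairing_nat\<close>.\<close>

lemma extension_multiplicity:
  assumes r: "minimal_projection GH r" and p: "minimal_projection G p"
  defines "m \<equiv> \<Sum>y\<in>carrier G. extension r y * p (inv y)"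
  shows "m \<in> \<int>" "Re m \<ge> 0"
proof -
  have pr: "projection GH r" "r \<noteq> 0" using r unfolding minimal_projection_def by blast+
  have pp: "projection G p" "p \<noteq> 0" using p unfolding minimal_projection_def by blast+
  have r0: "r x = 0" if "x \<notin> H" for x using pr that by (simp add: projection_def falg_def)
  have Nats_Ints: "x \<in> \<nat> \<Longrightarrow> x \<in> \<int>" for x :: complex by (auto elim: Nats_cases)
  define D where "D = of_nat (card H) * r \<one>"
  have D: "D \<in> \<int>" using GH_projection_trace_nat[OF pr(1)] by (simp add: D_def Nats_Ints)
  have D0: "Re D > 0" using GH_projection_at_one(2)[OF pr] card_H_pos by (simp add: D_def)
  have u: "projection G (uniform H)"
    using projection_subgroup[OF subgroup_H] GH_projection_uniform_carrier by simp
  have uG: "class_sum G (uniform (carrier G)) y = 1" if "y \<in> carrier G" for y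
  proof -
    have "complex_of_nat (card (carrier G)) \<noteq> 0" using one_closed by auto
    thus ?thesis using that by (simp add: class_sum_def uniform_def)
  qed
  have "m = (\<Sum>y\<in>carrier G. class_sum G r y * p (inv y)) - D * (\<Sum>y\<in>carrier G. class_sum G (uniform H) y * p (inv y))
      + D * (\<Sum>y\<in>carrier G. 1 * p (inv y))"
    unfolding m_def sum_distrib_left sum_subtractf[symmetric] sum.distrib[symmetric]
    by (rule sum.cong) (simp_all add: extension_def D_def algebra_simps)
  also have "(\<Sum>y\<in>carrier G. 1 * p (inv y)) = (\<Sum>y\<in>carrier G. class_sum G (uniform (carrier G)) y * p (inv y))"
    by (rule sum.cong) (simp_all add: uG)
  also have "(\<Sum>y\<in>carrier G. class_sum G r y * p (inv y)) - D * (\<Sum>y\<in>carrier G. class_sum G (uniform H) y * p (inv y))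
      + D * (\<Sum>y\<in>carrier G. class_sum G (uniform (carrier G)) y * p (inv y)) \<in> \<int>"
    unfolding pairing_class_sum[symmetric]
    by (intro Ints_add Ints_diff Ints_mult D Nats_Ints pairing_nat pp(1) u
        projection_uniform_carrier projection_subgroup[OF subgroup_H pr(1)])
  finally show m: "m \<in> \<int>" .
  then obtain k where k: "m = of_int k" by (auto elim: Ints_cases)
  define g where "g = complex_of_nat (card (carrier G))"
  have g0: "Re g > 0" using one_closed by (auto simp: g_def card_gt_0_iff)
  have Em: "(\<Sum>y\<in>carrier G. extension r y * cnj (class_sum G p y)) = g * m"
    unfolding m_def g_def by (rule class_function_inner) (use extension_conj pp(1) in auto)
  \<comment> \<open>The multiplicity is an integer, so conjugation leaves it unchanged.\<close>
  have Em': "(\<Sum>y\<in>carrier G. cnj (extension r y) * class_sum G p y) = g * m"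
    using arg_cong[OF Em, of cnj] by (simp add: k g_def)
  have pn: "(\<Sum>y\<in>carrier G. class_sum G p y * cnj (class_sum G p y)) = g"
    using class_function_inner[of "class_sum G p" p, OF class_sum_conj pp(1)] minimal_pairing_self[OF p]
    by (simp add: pairing_class_sum g_def)
  \<comment> \<open>the two class functions have norm 1 and a sum that does not vanish at 1, so \<open>2 + 2 m > 0\<close>\<close>
  have "of_real (\<Sum>y\<in>carrier G. (cmod (extension r y + class_sum G p y))\<^sup>2)
      = (\<Sum>y\<in>carrier G. extension r y * cnj (extension r y)) + (\<Sum>y\<in>carrier G. extension r y * cnj (class_sum G p y))
      + (\<Sum>y\<in>carrier G. cnj (extension r y) * class_sum G p y) + (\<Sum>y\<in>carrier G. class_sum G p y * cnj (class_sum G p y))"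
    unfolding of_real_sum complex_norm_square sum.distrib[symmetric]
    by (rule sum.cong) (simp_all add: algebra_simps)
  also have "\<dots> = 2 * g * (1 + m)"
    unfolding Em Em' pn extension_norm[OF r] by (simp add: g_def algebra_simps)
  finally have "complex_of_real (\<Sum>y\<in>carrier G. (cmod (extension r y + class_sum G p y))\<^sup>2) = 2 * g * (1 + m)" .
  from arg_cong[OF this, of Re]
  have e: "(\<Sum>y\<in>carrier G. (cmod (extension r y + class_sum G p y))\<^sup>2) = 2 * Re g * (1 + of_int k)"
    by (simp only: Re_complex_of_real) (simp add: g_def k)
  have "Re (extension r \<one> + class_sum G p \<one>) > 0"
    using D0 projection_at_one(2)[OF pp] g0
    by (simp add: extension_values(1)[of r, OF r0] class_sum_one D_def g_def add_pos_pos)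
  hence "extension r \<one> + class_sum G p \<one> \<noteq> 0" by (metis less_irrefl zero_complex.simps(1))
  hence "(\<Sum>y\<in>carrier G. (cmod (extension r y + class_sum G p y))\<^sup>2) > 0"
    by (intro sum_pos2[of _ "\<one>"]) auto
  hence "real_of_int (1 + k) > 0" using g0 unfolding e by (simp add: zero_less_mult_iff)
  hence "k \<ge> 0" by linarith
  thus "Re m \<ge> 0" by (simp add: k)
qed

text \<open>Since \<open>extension\<close> is linear, the \<open>m i\<close> add up to the sum
  formed with the extension of \<open>point_mass \<one>\<close>, the regular character of
  \<open>H\<close>. That extension is \<open>card H\<close> on \<open>N\<close> and 0 elsewhere, so
  \<open>card H\<close> times the sum over \<open>N\<close> is a sum of nonnegative
  integers.\<close>

lemma kernel_sum_nonneg: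
  assumes p: "minimal_projection G p"
  shows "\<exists>c\<ge>0. (\<Sum>y\<in>N. p (inv y)) = of_real c"
proof -
  obtain n :: nat and r where r: "\<And>i. i < n \<Longrightarrow> minimal_projection GH (r i)"
    and r1: "\<And>x. point_mass \<one> x = (\<Sum>i<n. r i x)"
    using GH_one_decomposition by blast
  define m where "m i = (\<Sum>y\<in>carrier G. extension (r i) y * p (inv y))" for i
  have m: "m i \<in> \<int>" "Re (m i) \<ge> 0" if "i < n" for i
    using extension_multiplicity[OF r[OF that] p] by (simp_all add: m_def)
  have s: "(\<Sum>i<n. extension (r i) y) = extension (point_mass \<one>) y" for y
    by (simp add: extension_def class_sum_def r1 sum.distrib sum_distrib_left sum_distrib_right
        sum.swap[of _ "carrier G"])
  have d0: "point_mass \<one> x = 0" if "x \<notin> H" for x using that by (auto simp: point_mass_def)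
  have e: "extension (point_mass \<one>) y = (if y \<in> N then of_nat (card H) else 0)"
    if y: "y \<in> carrier G" for y
  proof (cases "y \<in> N")
    case True
    thus ?thesis using extension_values(3)[of "point_mass \<one>", OF d0 True] by (simp add: point_mass_def)
  next
    case False
    then obtain x h where x: "x \<in> carrier G" and h: "h \<in> H" "h \<noteq> \<one>" and "y = x \<otimes> h \<otimes> inv x"
      using not_kernel y by blast
    hence "extension (point_mass \<one>) y = extension (point_mass \<one>) h" by (simp add: extension_conj)
    also have "\<dots> = class_sum GH (point_mass \<one>) h" by (rule extension_values(2)[OF d0 h])
    also have "\<dots> = (\<Sum>z\<in>H. point_mass \<one> (z \<otimes> h \<otimes> inv z))"
      by (simp add: class_sum_def inv_GH cong: sum.cong)
    also have "\<dots> = 0"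
    proof (rule sum.neutral, rule ballI)
      fix z assume z: "z \<in> H"
      have "z \<otimes> h \<otimes> inv z \<noteq> \<one>"
        using conj_not_kernel[OF h, of z] z by auto
      thus "point_mass \<one> (z \<otimes> h \<otimes> inv z) = 0" by (simp add: point_mass_def)
    qed
    finally show ?thesis using False by simp
  qed
  have "(\<Sum>i<n. m i) = (\<Sum>y\<in>carrier G. (\<Sum>i<n. extension (r i) y) * p (inv y))"
    unfolding m_def sum_distrib_right by (rule sum.swap)
  also have "\<dots> = (\<Sum>y\<in>carrier G. if y \<in> N then of_nat (card H) * p (inv y) else 0)"
    by (rule sum.cong) (simp_all add: s e)
  also have "\<dots> = (\<Sum>y\<in>N. of_nat (card H) * p (inv y))"
    using kernel_subset by (simp add: sum.If_cases Int_absorb1)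
  finally have eq: "(\<Sum>i<n. m i) = of_nat (card H) * (\<Sum>y\<in>N. p (inv y))" by (simp add: sum_distrib_left)
  have "(\<Sum>i<n. m i) \<in> \<int>" using m(1) by (intro Ints_sum) auto
  then obtain k where k: "(\<Sum>i<n. m i) = of_int k" by (auto elim: Ints_cases)
  have "Re (\<Sum>i<n. m i) \<ge> 0" unfolding Re_sum using m(2) by (intro sum_nonneg) auto
  hence "k \<ge> 0" by (simp add: k)
  moreover have cH: "complex_of_nat (card H) \<noteq> 0" using card_H_pos by (metis less_irrefl of_nat_eq_0_iff)
  have "(\<Sum>y\<in>N. p (inv y)) = of_real (of_int k / of_nat (card H))"
    using eq cH by (simp only: k) simp
  ultimately show ?thesis by (intro exI[of _ "of_int k / of_nat (card H)"]) simp
qed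

section \<open>Positive definiteness of the indicator of the kernel\<close>

definition kernel_indicator :: "'a \<Rightarrow> complex" where
  "kernel_indicator x = (if x \<in> N then 1 else 0)"

text \<open>As a class function, the indicator \<open>b\<close> is central, so
  \<open>b p = p b p\<close> is a multiple of \<open>p\<close> by minimality. Values at
  \<open>\<one>\<close> show that the factor is the sum of \<open>kernel_sum_nonneg\<close> divided
  by \<open>p \<one>\<close>.\<close>

lemma kernel_indicator_eigenvalue:
  assumes p: "minimal_projection G p"
  shows "\<exists>c\<ge>0. conv G kernel_indicator p = scl (of_real c) p"
proof -
  let ?b = kernel_indicator
  have pp: "projection G p" "p \<noteq> 0" using p unfolding minimal_projection_def by blast+
  have b: "?b \<in> falg G" using kernel_subset by (auto simp: falg_def kernel_indicator_def)
  have bc: "?b (x \<otimes> w \<otimes> inv x) = ?b w" if "x \<in> carrier G" "w \<in> carrier G" for x w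
    using kernel_conj[of w x] kernel_conj[of "x \<otimes> w \<otimes> inv x" "inv x"] that
    by (auto simp: kernel_indicator_def m_assoc)
  have comm: "conv G p ?b = conv G ?b p"
  proof (rule falg_eqI)
    fix x assume x: "x \<in> carrier G"
    have "conv G p ?b x = (\<Sum>y\<in>carrier G. p y * ?b (inv y \<otimes> x))" using x by (simp add: conv_def)
    also have "\<dots> = (\<Sum>v\<in>carrier G. ?b v * p (inv v \<otimes> x))"
    proof (rule sum.reindex_bij_witness[of _ "\<lambda>v. inv v \<otimes> x" "\<lambda>y. x \<otimes> inv y"])
      fix y assume y: "y \<in> carrier G"
      have "?b (x \<otimes> inv y) = ?b (inv y \<otimes> x)"
        using bc[OF x, of "inv y \<otimes> x"] x y by (simp add: m_assoc)
      thus "?b (x \<otimes> inv y) * p (inv (x \<otimes> inv y) \<otimes> x) = p y * ?b (inv y \<otimes> x)"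
        using x y by (simp add: inv_mult_group m_assoc)
    qed (use x in \<open>simp_all add: inv_mult_group m_assoc\<close>)
    also have "\<dots> = conv G ?b p x" using x by (simp add: conv_def)
    finally show "conv G p ?b x = conv G ?b p x" .
  qed auto
  obtain c where "conv G p (conv G ?b p) = scl c p"
    using p b unfolding minimal_projection_def by blast
  hence c: "conv G ?b p = scl c p"
    using pp(1) by (metis comm conv_assoc projection_def)
  obtain d where d: "d \<ge> 0" "(\<Sum>y\<in>N. p (inv y)) = of_real d"
    using kernel_sum_nonneg[OF p] by blast
  have "c * p \<one> = (\<Sum>y\<in>carrier G. if y \<in> N then p (inv y) else 0)"
    using fun_cong[OF c, of \<one>] by (simp add: conv_def scl_def kernel_indicator_def if_distrib[of "\<lambda>u. u * _"] cong: if_cong)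
  also have "\<dots> = of_real d"
    using kernel_subset d by (simp add: sum.If_cases Int_absorb1)
  finally have cp: "c * p \<one> = of_real d" .
  have p1: "Re (p \<one>) > 0" by (rule projection_at_one(2)[OF pp])
  have "c = of_real (d / Re (p \<one>))"
    using cp projection_at_one(3)[OF pp(1)] p1
    by (metis less_irrefl nonzero_eq_divide_eq of_real_divide of_real_eq_0_iff)
  thus ?thesis using c d(1) p1 by (intro exI[of _ "d / Re (p \<one>)"]) simp
qed

text \<open>Multiplying the indicator by the decomposed unit writes it as a combination of the
  \<open>q i\<close> with coefficients \<open>c i \<ge> 0\<close>. On \<open>N\<close> it takes its
  value at \<open>\<one>\<close>, so by \<open>projection_translate\<close> every \<open>q i\<close>
  with nonzero coefficient is invariant under translation by elements of \<open>N\<close>, and the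
  indicator agrees at \<open>g \<otimes> h\<close> and \<open>\<one>\<close>.\<close>

lemma kernel_mult:
  assumes "g \<in> N" "h \<in> N"
  shows "g \<otimes> h \<in> N"
proof -
  let ?b = kernel_indicator
  have G: "g \<in> carrier G" "h \<in> carrier G" using assms kernel_subset by auto
  obtain n :: nat and q where q: "\<And>i. i < n \<Longrightarrow> minimal_projection G (q i)"
    and q1: "\<And>x. point_mass \<one> x = (\<Sum>i<n. q i x)"
    using one_decomposition by blast
  have "\<forall>i. \<exists>c. i < n \<longrightarrow> c \<ge> 0 \<and> conv G ?b (q i) = scl (complex_of_real c) (q i)"
    using kernel_indicator_eigenvalue[OF q] by blast
  then obtain c where c: "\<And>i. i < n \<Longrightarrow> c i \<ge> 0"
    "\<And>i. i < n \<Longrightarrow> conv G ?b (q i) = scl (complex_of_real (c i)) (q i)" by metis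
  have pq: "projection G (q i)" if "i < n" for i
    using q[OF that] unfolding minimal_projection_def by blast
  have b: "?b x = (\<Sum>i<n. of_real (c i) * q i x)" if x: "x \<in> carrier G" for x
  proof -
    have "?b x = (\<Sum>y\<in>carrier G. ?b y * point_mass \<one> (inv y \<otimes> x))"
    proof -
      have "point_mass \<one> (inv y \<otimes> x) = point_mass x y" if y: "y \<in> carrier G" for y
      proof -
        have "inv y \<otimes> x = \<one> \<longleftrightarrow> y = x" using x y by (metis inv_cancel_left(2) l_inv r_one)
        thus ?thesis by (simp add: point_mass_def)
      qed
      hence "(\<Sum>y\<in>carrier G. ?b y * point_mass \<one> (inv y \<otimes> x)) = (\<Sum>y\<in>carrier G. point_mass x y * ?b y)"
        by (intro sum.cong refl) simp
      thus ?thesis by (simp add: sum_point_mass[OF x])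
    qed
    also have "\<dots> = (\<Sum>y\<in>carrier G. \<Sum>i<n. ?b y * q i (inv y \<otimes> x))"
      by (simp only: q1 sum_distrib_left)
    also have "\<dots> = (\<Sum>i<n. \<Sum>y\<in>carrier G. ?b y * q i (inv y \<otimes> x))" by (rule sum.swap)
    also have "\<dots> = (\<Sum>i<n. conv G ?b (q i) x)" using x by (simp add: conv_def)
    also have "\<dots> = (\<Sum>i<n. of_real (c i) * q i x)" by (rule sum.cong) (simp_all add: c scl_def)
    finally show ?thesis .
  qed
  have eq: "c i = 0 \<or> Re (q i x) = Re (q i \<one>)" if x: "x \<in> N" and i: "i < n" for x i
  proof -
    have xG: "x \<in> carrier G" using x kernel_subset by auto
    have "(\<Sum>i<n. of_real (c i) * q i x) = (\<Sum>i<n. of_real (c i) * q i \<one>)"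
      using b[OF xG] b[OF one_closed] x by (simp add: kernel_indicator_def)
    from arg_cong[OF this, of Re]
    have "(\<Sum>i<n. c i * (Re (q i \<one>) - Re (q i x))) = 0"
      by (simp add: right_diff_distrib sum_subtractf)
    moreover have "c i * (Re (q i \<one>) - Re (q i x)) \<ge> 0" if "i < n" for i
      using c(1)[OF that] projection_translate(1)[OF pq[OF that] xG] by simp
    ultimately have "c i * (Re (q i \<one>) - Re (q i x)) = 0"
      using i by (subst (asm) sum_nonneg_eq_0_iff) auto
    thus ?thesis by auto
  qed
  have "of_real (c i) * q i (g \<otimes> h) = of_real (c i) * q i \<one>" if i: "i < n" for i
  proof (cases "c i = 0")
    case False
    have "q i (g \<otimes> h) = q i h"
      using projection_translate(2)[OF pq[OF i] G(1) _ G(2)] eq[OF assms(1) i] False by simp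
    also have "q i (h \<otimes> \<one>) = q i \<one>"
      using projection_translate(2)[OF pq[OF i] G(2) _ one_closed] eq[OF assms(2) i] False by simp
    hence "q i h = q i \<one>" using G by simp
    finally show ?thesis by simp
  qed simp
  hence "(\<Sum>i<n. of_real (c i) * q i (g \<otimes> h)) = (\<Sum>i<n. of_real (c i) * q i \<one>)"
    by (intro sum.cong) (simp_all del: mult_cancel_left)
  hence "?b (g \<otimes> h) = ?b \<one>" using b[of "g \<otimes> h"] b[of \<one>] G by simp
  thus ?thesis by (simp add: kernel_indicator_def split: if_splits)
qed

lemma subgroup_kernel: "subgroup N G"
  by (rule subgroupI) (use kernel_subset one_kernel kernel_inv kernel_mult in \<open>blast+\<close>)

end

section \<open>Burnside's lemma for tuples\<close>

definition centralizer :: "('a, 'b) monoid_scheme \<Rightarrow> 'a \<Rightarrow> 'a set" where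
  "centralizer G g = {x \<in> carrier G. g \<otimes>\<^bsub>G\<^esub> x = x \<otimes>\<^bsub>G\<^esub> g}"

context fin_group
begin

lemma finite_tuples [simp]: "finite (tuples G n)"
  by (simp add: tuples_def finite_PiE)

text \<open>The value \<open>undefined\<close> from \<open>n\<close> on keeps the result in the
  extensional space \<open>tuples G n\<close>, so that conjugacy of tuples becomes an equation
  between functions.\<close>

definition act :: "nat \<Rightarrow> 'a \<Rightarrow> (nat \<Rightarrow> 'a) \<Rightarrow> nat \<Rightarrow> 'a" where
  "act n g x = (\<lambda>i. if i < n then g \<otimes> x i \<otimes> inv g else undefined)"

lemma tuplesD: "x \<in> tuples G n \<Longrightarrow> i < n \<Longrightarrow> x i \<in> carrier G"
  by (auto simp: tuples_def)

lemma act_closed: "g \<in> carrier G \<Longrightarrow> x \<in> tuples G n \<Longrightarrow> act n g x \<in> tuples G n"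
  by (auto simp: act_def tuples_def PiE_iff extensional_def)

lemma act_mult:
  "g \<in> carrier G \<Longrightarrow> h \<in> carrier G \<Longrightarrow> x \<in> tuples G n \<Longrightarrow> act n (g \<otimes> h) x = act n g (act n h x)"
  by (auto simp: act_def fun_eq_iff m_assoc inv_mult_group dest: tuplesD)

lemma act_one: "x \<in> tuples G n \<Longrightarrow> act n \<one> x = x"
  by (auto simp: act_def fun_eq_iff tuples_def PiE_iff extensional_def)

lemma sim_conj_rel_iff:
  "(x, y) \<in> sim_conj_rel G n \<longleftrightarrow> x \<in> tuples G n \<and> (\<exists>g\<in>carrier G. y = act n g x)"
proof -
  have "y = act n g x \<longleftrightarrow> (\<forall>i<n. y i = g \<otimes> x i \<otimes> inv g)" if "y \<in> tuples G n" for g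
    using that by (auto simp: act_def fun_eq_iff tuples_def PiE_iff extensional_def)
  thus ?thesis using act_closed unfolding sim_conj_rel_def by blast
qed

lemma equiv_sim_conj_rel: "equiv (tuples G n) (sim_conj_rel G n)"
proof (rule equivI)
  show "sim_conj_rel G n \<subseteq> tuples G n \<times> tuples G n" by (auto simp: sim_conj_rel_def)
  show "refl_on (tuples G n) (sim_conj_rel G n)"
    by (rule refl_onI) (metis sim_conj_rel_iff act_one one_closed)
  show "sym (sim_conj_rel G n)"
  proof (rule symI)
    fix x y assume "(x, y) \<in> sim_conj_rel G n"
    then obtain g where x: "x \<in> tuples G n" and g: "g \<in> carrier G" and y: "y = act n g x"
      by (auto simp: sim_conj_rel_iff)
    have "x = act n (inv g) y" using x g by (simp add: y act_mult[symmetric] act_one)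
    thus "(y, x) \<in> sim_conj_rel G n" using x g y act_closed by (auto simp: sim_conj_rel_iff)
  qed
  show "trans (sim_conj_rel G n)"
    by (rule transI) (metis sim_conj_rel_iff act_mult m_closed)
qed

text \<open>The fibres of \<open>\<lambda>g. act n g x\<close> over the orbit are left cosets of the
  stabiliser.\<close>

lemma orbit_stabilizer:
  assumes x: "x \<in> tuples G n"
  shows "card (carrier G) = card (sim_conj_rel G n `` {x}) * card {g \<in> carrier G. act n g x = x}"
proof -
  let ?S = "{g \<in> carrier G. act n g x = x}"
  have orb: "sim_conj_rel G n `` {x} = (\<lambda>g. act n g x) ` carrier G"
    using x by (auto simp: sim_conj_rel_iff)
  have fibre: "card {g \<in> carrier G. act n g x = act n a x} = card ?S" if a: "a \<in> carrier G" for a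
  proof (rule bij_betw_same_card[symmetric], rule bij_betwI[of "\<lambda>g. a \<otimes> g" _ _ "\<lambda>g. inv a \<otimes> g"])
    show "(\<lambda>g. a \<otimes> g) \<in> ?S \<rightarrow> {g \<in> carrier G. act n g x = act n a x}"
      using a x by (auto simp: act_mult)
    show "(\<lambda>g. inv a \<otimes> g) \<in> {g \<in> carrier G. act n g x = act n a x} \<rightarrow> ?S"
      using a x by (auto simp: act_mult) (simp add: act_mult[symmetric] act_one)
  qed (use a in auto)
  have "card (carrier G) = (\<Sum>y\<in>(\<lambda>g. act n g x) ` carrier G. card {g \<in> carrier G. act n g x = y})"
    by (subst sum.image_gen[of "carrier G" "\<lambda>_. 1 :: nat" "\<lambda>g. act n g x", simplified]) simp_all
  also have "\<dots> = (\<Sum>y\<in>(\<lambda>g. act n g x) ` carrier G. card ?S)"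
    by (rule sum.cong) (auto simp: fibre)
  finally show ?thesis by (simp add: orb)
qed

lemma fixed_tuples:
  assumes g: "g \<in> carrier G"
  shows "card {x \<in> tuples G n. act n g x = x} = card (centralizer G g) ^ n"
proof -
  have fixed_iff: "g \<otimes> z \<otimes> inv g = z \<longleftrightarrow> g \<otimes> z = z \<otimes> g" if "z \<in> carrier G" for z
    using inv_solve_right'[of z "g \<otimes> z" g] g that by simp
  have "{x \<in> tuples G n. act n g x = x} = {0..<n} \<rightarrow>\<^sub>E centralizer G g"
  proof (intro equalityI subsetI)
    fix x assume "x \<in> {x \<in> tuples G n. act n g x = x}"
    hence x: "x \<in> tuples G n" "act n g x = x" by auto
    have "g \<otimes> x i \<otimes> inv g = x i" if "i < n" for i
      using fun_cong[OF x(2), of i] that by (simp add: act_def)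
    thus "x \<in> {0..<n} \<rightarrow>\<^sub>E centralizer G g"
      using x(1) fixed_iff by (auto simp: tuples_def PiE_iff centralizer_def)
  next
    fix x assume x: "x \<in> {0..<n} \<rightarrow>\<^sub>E centralizer G g"
    have "g \<otimes> x i \<otimes> inv g = x i" if "i < n" for i
      using x that fixed_iff[of "x i"] by (auto simp: PiE_iff centralizer_def)
    with x show "x \<in> {x \<in> tuples G n. act n g x = x}"
      by (auto simp: tuples_def PiE_iff centralizer_def act_def fun_eq_iff extensional_def)
  qed
  thus ?thesis by (simp add: card_PiE)
qed

text \<open>Pairs \<open>(g, x)\<close> with \<open>act n g x = x\<close> are counted by
  \<open>g\<close> through \<open>fixed_tuples\<close>, and by \<open>x\<close> orbit after orbit,
  each orbit contributing \<open>card (carrier G)\<close>.\<close>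

lemma burnside_alpha:
  "card (carrier G) * alpha G n = (\<Sum>g\<in>carrier G. card (centralizer G g) ^ n)"
proof -
  let ?r = "sim_conj_rel G n" and ?T = "tuples G n"
  have eqv: "equiv ?T ?r" by (rule equiv_sim_conj_rel)
  have "(\<Sum>g\<in>carrier G. card (centralizer G g) ^ n) = (\<Sum>g\<in>carrier G. card {x \<in> ?T. act n g x = x})"
    by (rule sum.cong) (simp_all add: fixed_tuples)
  also have "\<dots> = (\<Sum>g\<in>carrier G. \<Sum>x\<in>?T. if act n g x = x then 1 else 0)"
    by (simp add: sum.If_cases Int_def)
  also have "\<dots> = (\<Sum>x\<in>?T. \<Sum>g\<in>carrier G. if act n g x = x then 1 else 0)"
    by (rule sum.swap)
  also have "\<dots> = (\<Sum>x\<in>?T. card {g \<in> carrier G. act n g x = x})"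
    by (simp add: sum.If_cases Int_def)
  also have "\<dots> = (\<Sum>x\<in>\<Union>(?T // ?r). card {g \<in> carrier G. act n g x = x})"
    by (simp add: Union_quotient[OF eqv])
  also have "\<dots> = (\<Sum>C\<in>?T // ?r. \<Sum>x\<in>C. card {g \<in> carrier G. act n g x = x})"
  proof (subst sum.Union_disjoint)
    show "\<forall>C\<in>?T // ?r. finite C"
      using in_quotient_imp_subset[OF eqv] finite_subset[OF _ finite_tuples] by blast
    show "\<forall>A\<in>?T // ?r. \<forall>B\<in>?T // ?r. A \<noteq> B \<longrightarrow> A \<inter> B = {}"
      using quotient_disj[OF eqv] by blast
  qed simp
  also have "\<dots> = (\<Sum>C\<in>?T // ?r. card (carrier G))"
  proof (rule sum.cong[OF refl])
    fix C assume C: "C \<in> ?T // ?r"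
    have CT: "C \<subseteq> ?T" using in_quotient_imp_subset[OF eqv C] .
    have cls: "?r `` {x} = C" if "x \<in> C" for x
      using C that by (metis eqv quotientE equiv_class_eq Image_singleton_iff)
    obtain x0 where x0: "x0 \<in> C" using in_quotient_imp_non_empty[OF eqv C] by blast
    have C0: "card C > 0"
      using x0 finite_subset[OF CT finite_tuples] by (auto simp: card_gt_0_iff)
    \<comment> \<open>The division is exact by \<open>orbit_stabilizer\<close>, and the stabiliser
      order is constant on the orbit.\<close>
    have "card {g \<in> carrier G. act n g x = x} = card (carrier G) div card C" if "x \<in> C" for x
      using orbit_stabilizer[of x n] cls[OF that] CT that C0 by auto
    hence "(\<Sum>x\<in>C. card {g \<in> carrier G. act n g x = x}) = card C * (card (carrier G) div card C)"
      by simp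
    also have "\<dots> = card (carrier G)"
      using orbit_stabilizer[of x0 n] cls[OF x0] CT x0 by (metis dvd_mult_div_cancel dvd_triv_left subsetD)
    finally show "(\<Sum>x\<in>C. card {g \<in> carrier G. act n g x = x}) = card (carrier G)" .
  qed
  also have "\<dots> = card (carrier G) * alpha G n" by (simp add: alpha_def mult.commute)
  finally show ?thesis ..
qed

lemma card_conj_centralizer:
  assumes "y \<in> carrier G" "z \<in> carrier G"
  shows "card (centralizer G (z \<otimes> y \<otimes> inv z)) = card (centralizer G y)"
proof (rule bij_betw_same_card, rule bij_betwI[of "\<lambda>x. inv z \<otimes> x \<otimes> z" _ _ "\<lambda>x. z \<otimes> x \<otimes> inv z"])
  show "(\<lambda>x. inv z \<otimes> x \<otimes> z) \<in> centralizer G (z \<otimes> y \<otimes> inv z) \<rightarrow> centralizer G y"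
  proof
    fix x assume "x \<in> centralizer G (z \<otimes> y \<otimes> inv z)"
    hence x: "x \<in> carrier G" "z \<otimes> y \<otimes> inv z \<otimes> x = x \<otimes> (z \<otimes> y \<otimes> inv z)"
      by (auto simp: centralizer_def)
    from arg_cong[OF x(2), of "\<lambda>u. inv z \<otimes> u \<otimes> z"]
    show "inv z \<otimes> x \<otimes> z \<in> centralizer G y"
      using x(1) assms by (simp add: centralizer_def m_assoc)
  qed
  show "(\<lambda>x. z \<otimes> x \<otimes> inv z) \<in> centralizer G y \<rightarrow> centralizer G (z \<otimes> y \<otimes> inv z)"
  proof
    fix x assume "x \<in> centralizer G y"
    hence x: "x \<in> carrier G" "y \<otimes> x = x \<otimes> y" by (auto simp: centralizer_def)
    from arg_cong[OF x(2), of "\<lambda>u. z \<otimes> u \<otimes> inv z"]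
    show "z \<otimes> x \<otimes> inv z \<in> centralizer G (z \<otimes> y \<otimes> inv z)"
      using x(1) assms by (simp add: centralizer_def m_assoc)
  qed
qed (use assms in \<open>auto simp: centralizer_def m_assoc\<close>)

lemma centralizer_one: "centralizer G \<one> = carrier G"
  by (auto simp: centralizer_def)

end

section \<open>Centralisers in a Frobenius group\<close>

context frobenius_group
begin

text \<open>Conjugation by a commuting \<open>x\<close> fixes the nontrivial element
  \<open>h\<close> of \<open>H\<close>, so malnormality puts \<open>x\<close> in
  \<open>H\<close>.\<close>

lemma centralizer_H:
  assumes "h \<in> H" "h \<noteq> \<one>"
  shows "centralizer G h = centralizer (G\<lparr>carrier := H\<rparr>) h"
proof -
  have "x \<in> H" if x: "x \<in> carrier G" "h \<otimes> x = x \<otimes> h" for x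
  proof (rule conj_in_H[OF x(1) assms])
    have "x \<otimes> h \<otimes> inv x = h" using x assms(1) by (simp flip: x(2) add: m_assoc)
    thus "x \<otimes> h \<otimes> inv x \<in> H" using assms(1) by simp
  qed
  thus ?thesis using H.subset by (auto simp: centralizer_def)
qed

text \<open>An \<open>x\<close> outside \<open>N\<close> is conjugate by some \<open>a\<close> to a
  nontrivial \<open>h\<close> in \<open>H\<close>. If it commutes with \<open>g\<close>, then
  \<open>inv a \<otimes> g \<otimes> a\<close> commutes with \<open>h\<close> and so lies in
  \<open>H\<close>, which is impossible for a nontrivial \<open>g\<close> in
  \<open>N\<close>.\<close>

lemma centralizer_kernel:
  assumes g: "g \<in> N" "g \<noteq> \<one>"
  shows "centralizer G g = centralizer (G\<lparr>carrier := N\<rparr>) g"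
proof -
  have gG: "g \<in> carrier G" using g kernel_subset by blast
  have "x \<in> N" if x: "x \<in> carrier G" "g \<otimes> x = x \<otimes> g" for x
  proof (rule ccontr)
    assume "x \<notin> N"
    then obtain a h where a: "a \<in> carrier G" and h: "h \<in> H" "h \<noteq> \<one>" and xa: "x = a \<otimes> h \<otimes> inv a"
      using not_kernel x(1) by blast
    define k where "k = inv a \<otimes> g \<otimes> a"
    have k: "k \<in> carrier G" using a gG by (simp add: k_def)
    have "k \<otimes> h = h \<otimes> k"
      using arg_cong[OF x(2), of "\<lambda>u. inv a \<otimes> u \<otimes> a"] a h gG by (simp add: k_def xa m_assoc)
    hence "k \<otimes> h \<otimes> inv k = h" using k h by (simp add: m_assoc)
    hence "k \<in> H" using conj_in_H[OF k h] h by simp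
    thus False using g a by (auto simp: k_def kernel_iff)
  qed
  thus ?thesis using kernel_subset by (auto simp: centralizer_def)
qed

text \<open>One coefficient of the theorem after Burnside's lemma. Centraliser orders are class
  functions, so \<open>sum_frobenius\<close> applies; the subtracted powers are the contributions of
  \<open>\<one>\<close> to the sums over \<open>N\<close> and \<open>H\<close>.\<close>

lemma centralizer_sum:
  "(\<Sum>g\<in>carrier G. of_nat (card (centralizer G g)) ^ n :: rat)
    = of_nat (card (carrier G)) ^ n
    + ((\<Sum>g\<in>N. of_nat (card (centralizer (G\<lparr>carrier := N\<rparr>) g)) ^ n) - of_nat (card N) ^ n)
    + of_nat (card N) * ((\<Sum>h\<in>H. of_nat (card (centralizer (G\<lparr>carrier := H\<rparr>) h)) ^ n) - of_nat (card H) ^ n)"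
proof -
  have split: "(\<Sum>g\<in>K. of_nat (card (centralizer (G\<lparr>carrier := K\<rparr>) g)) ^ n :: rat) - of_nat (card K) ^ n
      = (\<Sum>g\<in>K - {\<one>}. of_nat (card (centralizer (G\<lparr>carrier := K\<rparr>) g)) ^ n)"
    if K: "K \<subseteq> carrier G" "\<one> \<in> K" for K
  proof -
    have "centralizer (G\<lparr>carrier := K\<rparr>) \<one> = K" using K by (auto simp: centralizer_def)
    thus ?thesis using K finite_subset[OF K(1)] by (simp add: sum.remove[of K "\<one>"])
  qed
  have "(\<Sum>g\<in>carrier G. of_nat (card (centralizer G g)) ^ n :: rat)
      = of_nat (card (centralizer G \<one>)) ^ n + (\<Sum>g\<in>N - {\<one>}. of_nat (card (centralizer G g)) ^ n)
        + of_nat (card N) * (\<Sum>h\<in>H - {\<one>}. of_nat (card (centralizer G h)) ^ n)"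
    by (rule sum_frobenius) (simp add: card_conj_centralizer)
  thus ?thesis
    unfolding split[OF kernel_subset one_kernel] split[OF H.subset H.one_closed] centralizer_one
    by (simp add: centralizer_kernel centralizer_H)
qed

end

section \<open>Passage to generating functions\<close>

lemma fps_nth_inverse_geometric:
  "fps_nth (inverse (1 - of_nat c * fps_X) :: rat fps) n = of_nat c ^ n"
proof -
  have "Abs_fps (\<lambda>n. of_nat c ^ n :: rat) * (1 - of_nat c * fps_X) = 1"
  proof (rule fps_ext)
    fix n
    show "fps_nth (Abs_fps (\<lambda>n. of_nat c ^ n :: rat) * (1 - of_nat c * fps_X)) n = fps_nth 1 n"
      by (cases n) (simp_all add: right_diff_distrib fps_of_nat[symmetric] mult.assoc[symmetric] mult.commute[of _ "fps_const _"])
  qed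
  hence "inverse (1 - of_nat c * fps_X) = Abs_fps (\<lambda>n. of_nat c ^ n :: rat)"
    by (metis fps_inverse_unique mult.commute)
  thus ?thesis by simp
qed

lemma fps_nth_A:
  assumes "fin_group G"
  shows "fps_nth (of_nat (card (carrier G)) * A_fps G) n
    = (\<Sum>g\<in>carrier G. of_nat (card (centralizer G g)) ^ n)"
proof -
  have "(of_nat (card (carrier G) * alpha G n) :: rat) = of_nat (\<Sum>g\<in>carrier G. card (centralizer G g) ^ n)"
    by (simp only: fin_group.burnside_alpha[OF assms])
  thus ?thesis by (simp add: A_fps_def fps_of_nat[symmetric])
qed

theorem theorem9p2:
  fixes G :: "('a, 'b) monoid_scheme" and H N :: "'a set"
  assumes "group G" and "finite (carrier G)"
    and "frobenius_complement G H"
    and "N = frobenius_kernel G H"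
  shows "of_nat (card (carrier G)) * A_fps G =
           inverse (1 - of_nat (card (carrier G)) * fps_X)
         + (of_nat (card N) * A_fps (G\<lparr>carrier := N\<rparr>) - inverse (1 - of_nat (card N) * fps_X))
         + of_nat (card N) * (of_nat (card H) * A_fps (G\<lparr>carrier := H\<rparr>)
                               - inverse (1 - of_nat (card H) * fps_X))"
proof -
  interpret group G by fact
  interpret frobenius_group G H by unfold_locales fact+
  have sub: "fin_group (G\<lparr>carrier := K\<rparr>)" if "subgroup K G" for K
  proof -
    interpret K: group "G\<lparr>carrier := K\<rparr>" by (rule subgroup.subgroup_is_group[OF that is_group])
    show ?thesis by unfold_locales (use subgroup.subset[OF that] finite_subset in auto)
  qed
  show ?thesis
  proof (rule fps_ext)
    fix n
    have G: "fps_nth (of_nat (card (carrier G)) * A_fps G) n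
        = (\<Sum>g\<in>carrier G. of_nat (card (centralizer G g)) ^ n)"
      by (rule fps_nth_A) unfold_locales
    have K: "fps_nth (of_nat (card K) * A_fps (G\<lparr>carrier := K\<rparr>)) n
        = (\<Sum>g\<in>K. of_nat (card (centralizer (G\<lparr>carrier := K\<rparr>) g)) ^ n)" if "subgroup K G" for K
      using fps_nth_A[OF sub[OF that]] by simp
    have scale: "fps_nth (of_nat c * (f - h)) n = of_nat c * (fps_nth f n - fps_nth h n)"
      for c and f h :: "rat fps"
      by (simp add: fps_of_nat[symmetric])
    show "fps_nth (of_nat (card (carrier G)) * A_fps G) n
      = fps_nth (inverse (1 - of_nat (card (carrier G)) * fps_X)
         + (of_nat (card N) * A_fps (G\<lparr>carrier := N\<rparr>) - inverse (1 - of_nat (card N) * fps_X))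
         + of_nat (card N) * (of_nat (card H) * A_fps (G\<lparr>carrier := H\<rparr>)
                               - inverse (1 - of_nat (card H) * fps_X))) n"
      unfolding fps_add_nth fps_sub_nth fps_nth_inverse_geometric G
      \<comment> \<open>Frobenius's theorem enters here as \<open>subgroup_kernel\<close>: it makes
        \<open>N\<close> a group to which Burnside's lemma applies.\<close>
      unfolding scale fps_nth_inverse_geometric K[OF subgroup_H] assms(4) K[OF subgroup_kernel]
      by (rule centralizer_sum)
  qed
qed

end
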